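(* Let $f:\overline{\mathbf{C}}\to\overline{\mathbf{C}}$ be a rational function and let $\gamma\subset\overline{\mathbf{C}}$ be a Jordan analytic curve which is invariant under $f$, such that $f|_\gamma$ is not a homeomorphism and there is a repelling periodic point $a\in\gamma$ of $f$ with multiplier $\lambda$, $|\lambda|>1$. Assume in addition that at least one of the following holds: (a) $\gamma$ does not contain critical or neutral rational fixed points of $f$; (b) $\gamma\subset J(f)$. Then $\lambda$ is real, and there exist a non-hyperbolic Riemann surface $S$ with an anti-conformal involution $s:S\to S$, an endomorphism $g:S\to S$, and a non-constant holomorphic map $h:S\to\overline{\mathbf{C}}$ such that $g\circ s=s\circ g$, $h(X)\subset\gamma$ where $X\subset S$ is the set of points fixed by the involution $s$, and $$h\circ g=f^{n}\circ h$$ for some integer $n\geq 1$.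
   Context: $\overline{\mathbf{C}}$ is the Riemann sphere. $J(f)$ is the Julia set of $f$, and $f^n$ is the $n$-th iterate of $f$. A Jordan analytic curve is a Jordan curve (a homeomorphic image of a circle) in $\overline{\mathbf{C}}$ that is a real-analytic curve; it is invariant under $f$ if $f(\gamma)\subset\gamma$. The multiplier of a periodic point $a$ of period $p$ is the derivative $(f^p)'(a)$ (computed in a local coordinate at $a$); the point is repelling if the modulus of the multiplier is greater than $1$. A fixed point is critical if its multiplier is $0$, and neutral rational if its multiplier is a root of unity. Riemann surfaces are connected; a Riemann surface is non-hyperbolic if its universal cover is not the unit disc, i.e. it is conformally equivalent to $\overline{\mathbf{C}}$, $\mathbf{C}$, $\mathbf{C}^*=\mathbf{C}\setminus\{0\}$ or a complex torus. An endomorphism of $S$ is a holomorphic map $S\to S$. An anti-conformal involution of $S$ is an anti-holomorphic map $s:S\to S$ with $s\circ s=\mathrm{id}$. *)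

theory Defs
  imports "HOL-Complex_Analysis.Complex_Analysis" "HOL-Computational_Algebra.Polynomial"
begin

text \<open>
  A chart is a pair \<open>(U, \<phi>)\<close>; values of \<open>\<phi>\<close> outside \<open>U\<close>, and values of maps outside
  the underlying topological space, are irrelevant.  An atlas need not be maximal.
  Every Riemann surface has the cardinality of the continuum, so up to isomorphism its points
  can be taken in the type \<^typ>\<open>complex\<close>.
\<close>

record 'a surface =
  stop :: "'a topology"
  atlas :: "('a set \<times> ('a \<Rightarrow> complex)) set"

abbreviation points :: "'a surface \<Rightarrow> 'a set" where
  "points S \<equiv> topspace (stop S)"

definition riemann_surface :: "'a surface \<Rightarrow> bool" where
  "riemann_surface S \<longleftrightarrow>
     points S \<noteq> {} \<and> connected_space (stop S) \<and> Hausdorff_space (stop S) \<and>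
     (\<Union>(U, \<phi>)\<in>atlas S. U) = points S \<and>
     (\<forall>(U, \<phi>)\<in>atlas S. openin (stop S) U \<and> open (\<phi> ` U) \<and>
        homeomorphic_map (subtopology (stop S) U) (top_of_set (\<phi> ` U)) \<phi>) \<and>
     (\<forall>(U, \<phi>)\<in>atlas S. \<forall>(V, \<psi>)\<in>atlas S. (\<psi> \<circ> inv_into U \<phi>) holomorphic_on (\<phi> ` (U \<inter> V)))"

definition holomorphic_map :: "'a surface \<Rightarrow> 'b surface \<Rightarrow> ('a \<Rightarrow> 'b) \<Rightarrow> bool" where
  "holomorphic_map S T h \<longleftrightarrow>
     continuous_map (stop S) (stop T) h \<and>
     (\<forall>(U, \<phi>)\<in>atlas S. \<forall>(V, \<psi>)\<in>atlas T.
        (\<psi> \<circ> h \<circ> inv_into U \<phi>) holomorphic_on (\<phi> ` (U \<inter> h -` V)))"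

definition antiholomorphic_map :: "'a surface \<Rightarrow> 'b surface \<Rightarrow> ('a \<Rightarrow> 'b) \<Rightarrow> bool" where
  "antiholomorphic_map S T h \<longleftrightarrow>
     continuous_map (stop S) (stop T) h \<and>
     (\<forall>(U, \<phi>)\<in>atlas S. \<forall>(V, \<psi>)\<in>atlas T.
        (cnj \<circ> \<psi> \<circ> h \<circ> inv_into U \<phi>) holomorphic_on (\<phi> ` (U \<inter> h -` V)))"

definition anticonformal_involution :: "'a surface \<Rightarrow> ('a \<Rightarrow> 'a) \<Rightarrow> bool" where
  "anticonformal_involution S s \<longleftrightarrow> antiholomorphic_map S S s \<and> (\<forall>x\<in>points S. s (s x) = x)"

definition planar_surface :: "complex set \<Rightarrow> complex surface" where
  "planar_surface D = \<lparr>stop = top_of_set D, atlas = {(D, \<lambda>z. z)}\<rparr>"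

text \<open>Covering maps, phrased as in the library's \<^const>\<open>covering_space\<close>.\<close>

definition holomorphic_covering :: "'a surface \<Rightarrow> 'b surface \<Rightarrow> ('a \<Rightarrow> 'b) \<Rightarrow> bool" where
  "holomorphic_covering T S p \<longleftrightarrow>
     holomorphic_map T S p \<and> p ` points T = points S \<and>
     (\<forall>x\<in>points S. \<exists>V. x \<in> V \<and> openin (stop S) V \<and>
        (\<exists>\<U>. \<Union>\<U> = points T \<inter> p -` V \<and> pairwise disjnt \<U> \<and>
             (\<forall>U\<in>\<U>. openin (stop T) U \<and>
                homeomorphic_map (subtopology (stop T) U) (subtopology (stop S) V) p)))"

text \<open>
  As the unit disc is simply connected, it is the universal cover of \<open>S\<close> (up to conformal
  equivalence) iff there is a holomorphic covering map from the disc onto \<open>S\<close>.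
\<close>

definition non_hyperbolic :: "'a surface \<Rightarrow> bool" where
  "non_hyperbolic S \<longleftrightarrow>
     riemann_surface S \<and> \<not> (\<exists>p. holomorphic_covering (planar_surface (ball 0 1)) S p)"

text \<open>Points of the sphere are \<open>Some z\<close> with \<open>z\<close> finite, and \<open>None\<close>, the point at infinity.\<close>

type_synonym sphere_pt = "complex option"

definition recip_coord :: "sphere_pt \<Rightarrow> complex" where
  "recip_coord x = (case x of None \<Rightarrow> 0 | Some z \<Rightarrow> 1 / z)"

definition riemann_sphere :: "sphere_pt surface" where
  "riemann_sphere =
     \<lparr>stop = Alexandroff_compactification euclidean,
      atlas = {(range Some, the), (- {Some 0}, recip_coord)}\<rparr>"

text \<open>The value at infinity is the limit of \<open>p z / q z\<close> as \<open>z\<close> tends to infinity.\<close>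

definition rational_fun :: "complex poly \<Rightarrow> complex poly \<Rightarrow> sphere_pt \<Rightarrow> sphere_pt" where
  "rational_fun p q x =
     (let quot = (\<lambda>u v. if v = 0 then None else Some (u / v)) in
      case x of
        Some z \<Rightarrow> quot (poly p z) (poly q z)
      | None \<Rightarrow> let d = max (degree p) (degree q) in quot (coeff p d) (coeff q d))"

definition is_rational :: "(sphere_pt \<Rightarrow> sphere_pt) \<Rightarrow> bool" where
  "is_rational f \<longleftrightarrow> (\<exists>p q. q \<noteq> 0 \<and> coprime p q \<and> f = rational_fun p q)"

definition periodic_point :: "(sphere_pt \<Rightarrow> sphere_pt) \<Rightarrow> sphere_pt \<Rightarrow> bool" where
  "periodic_point f a \<longleftrightarrow> (\<exists>p\<ge>1. (f ^^ p) a = a)"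

definition period :: "(sphere_pt \<Rightarrow> sphere_pt) \<Rightarrow> sphere_pt \<Rightarrow> nat" where
  "period f a = (LEAST p. p \<ge> 1 \<and> (f ^^ p) a = a)"

text \<open>
  The derivative of \<open>F\<close> at a fixed point \<open>a\<close>, in the chart \<open>z\<close> if \<open>a\<close> is finite and \<open>1 / z\<close>
  if \<open>a\<close> is infinity.  Both charts are onto the complex plane.
\<close>

definition fixed_point_deriv :: "(sphere_pt \<Rightarrow> sphere_pt) \<Rightarrow> sphere_pt \<Rightarrow> complex" where
  "fixed_point_deriv F a =
     (let (U, \<phi>) = (if a = None then (- {Some 0}, recip_coord) else (range Some, the))
      in deriv (\<phi> \<circ> F \<circ> inv_into U \<phi>) (\<phi> a))"

definition multiplier :: "(sphere_pt \<Rightarrow> sphere_pt) \<Rightarrow> sphere_pt \<Rightarrow> complex" where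
  "multiplier f a = fixed_point_deriv (f ^^ period f a) a"

definition repelling :: "(sphere_pt \<Rightarrow> sphere_pt) \<Rightarrow> sphere_pt \<Rightarrow> bool" where
  "repelling f a \<longleftrightarrow> periodic_point f a \<and> cmod (multiplier f a) > 1"

definition critical_fixed_point :: "(sphere_pt \<Rightarrow> sphere_pt) \<Rightarrow> sphere_pt \<Rightarrow> bool" where
  "critical_fixed_point f a \<longleftrightarrow> f a = a \<and> multiplier f a = 0"

definition neutral_rational_fixed_point :: "(sphere_pt \<Rightarrow> sphere_pt) \<Rightarrow> sphere_pt \<Rightarrow> bool" where
  "neutral_rational_fixed_point f a \<longleftrightarrow> f a = a \<and> (\<exists>k\<ge>1. multiplier f a ^ k = 1)"

text \<open>
  Inverse stereographic projection onto the unit sphere of \<open>complex \<times> real\<close>; the distance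
  between images is the chordal metric.
\<close>

definition stereo :: "sphere_pt \<Rightarrow> complex \<times> real" where
  "stereo x = (case x of
      None \<Rightarrow> (0, 1)
    | Some z \<Rightarrow> (2 * z / of_real (1 + (cmod z)\<^sup>2), ((cmod z)\<^sup>2 - 1) / ((cmod z)\<^sup>2 + 1)))"

definition normal_family_on :: "sphere_pt set \<Rightarrow> (sphere_pt \<Rightarrow> sphere_pt) set \<Rightarrow> bool" where
  "normal_family_on U \<F> \<longleftrightarrow>
     (\<forall>F :: nat \<Rightarrow> sphere_pt \<Rightarrow> sphere_pt. range F \<subseteq> \<F> \<longrightarrow>
        (\<exists>(r :: nat \<Rightarrow> nat) G. strict_mono r \<and>
           (\<forall>K. compactin (stop riemann_sphere) K \<and> K \<subseteq> U \<longrightarrow>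
              uniform_limit K (\<lambda>k x. stereo (F (r k) x)) (\<lambda>x. stereo (G x)) sequentially)))"

definition fatou_set :: "(sphere_pt \<Rightarrow> sphere_pt) \<Rightarrow> sphere_pt set" where
  "fatou_set f =
     {x. \<exists>U. openin (stop riemann_sphere) U \<and> x \<in> U \<and> normal_family_on U (range (\<lambda>n. f ^^ n))}"

definition julia_set :: "(sphere_pt \<Rightarrow> sphere_pt) \<Rightarrow> sphere_pt set" where
  "julia_set f = - fatou_set f"

definition jordan_curve :: "sphere_pt set \<Rightarrow> bool" where
  "jordan_curve \<gamma> \<longleftrightarrow>
     (top_of_set (sphere (0 :: complex) 1)) homeomorphic_space (subtopology (stop riemann_sphere) \<gamma>)"

text \<open>
  Near each of its points \<open>\<gamma>\<close> has a regular real-analytic parametrization by an interval.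
  Such a parametrization \<open>\<psi>\<close> is the restriction to the real axis of a holomorphic map, which
  is injective near the interval as its derivative does not vanish there.
\<close>

definition real_analytic_curve :: "sphere_pt set \<Rightarrow> bool" where
  "real_analytic_curve \<gamma> \<longleftrightarrow>
     (\<forall>a\<in>\<gamma>. \<exists>\<psi>. holomorphic_map (planar_surface (ball 0 1)) riemann_sphere \<psi> \<and>
        inj_on \<psi> (ball 0 1) \<and> \<psi> 0 = a \<and>
        \<psi> ` ball 0 1 \<inter> \<gamma> = \<psi> ` (ball 0 1 \<inter> \<real>))"

definition jordan_analytic_curve :: "sphere_pt set \<Rightarrow> bool" where
  "jordan_analytic_curve \<gamma> \<longleftrightarrow> jordan_curve \<gamma> \<and> real_analytic_curve \<gamma>"

end

theory Submission
  imports Defs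
begin

text \<open>
  One may always take \<open>S = \<complex>\<close>, \<open>s\<close> the complex conjugation, \<open>g z = lam * z\<close> and \<open>n\<close> the period of \<open>a\<close>.
  Let \<open>\<psi>\<close> be the holomorphic parametrization of \<open>\<gamma>\<close> near \<open>a\<close>.  In the coordinate \<open>\<psi>\<close>, the \<open>n\<close>-th
  iterate of \<open>f\<close> becomes a germ \<open>G\<close> which fixes \<open>0\<close> and is real on the real axis because \<open>\<gamma>\<close> is
  invariant; hence \<open>lam\<close>, its derivative at \<open>0\<close>, is real.  As \<open>0\<close> is repelling, \<open>G\<close> has a local
  Poincare function \<open>\<Psi> z = lim G\<^sup>k (z / lam\<^sup>k)\<close> with \<open>\<Psi> (lam * z) = G (\<Psi> z)\<close>, again real on
  the real axis.  The functional equation extends \<open>\<psi> \<circ> \<Psi>\<close> to a map \<open>h\<close> from the plane to the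
  sphere, and \<open>h\<close> maps the real axis into \<open>\<gamma>\<close>, by invariance of \<open>\<gamma>\<close> once more.
\<close>

subsection \<open>Local Poincare functions\<close>

text \<open>
  Over \<open>k\<close> steps the Lipschitz constant exceeds \<open>\<mu> ^ k\<close> only by the factor \<open>1 + K T\<close>, where
  \<open>T = \<mu> ^ k * s\<close>.  With this \<open>K\<close> the factor is self-reproducing:
  \<open>(1 + 2 C T / \<mu>) (1 + K T) \<le> 1 + K \<mu> T\<close> as long as \<open>K T \<le> 1\<close>.
\<close>

lemma iterate_lipschitz:
  fixes F :: "complex \<Rightarrow> complex"
  assumes lip: "\<And>t u v. t \<le> \<rho> \<Longrightarrow> norm u \<le> t \<Longrightarrow> norm v \<le> t \<Longrightarrow>
                    norm (F u - F v) \<le> (\<mu> + C * t) * norm (u - v)"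
    and F0: "F 0 = 0" and \<mu>: "\<mu> > 1" and C: "C \<ge> 0" and K: "K = 4 * C / (\<mu> * (\<mu> - 1))"
    and "norm u \<le> s" "norm v \<le> s" "K * (\<mu> ^ k * s) \<le> 1" "2 * (\<mu> ^ k * s) \<le> \<rho>"
  shows "norm ((F ^^ k) u - (F ^^ k) v) \<le> \<mu> ^ k * (1 + K * (\<mu> ^ k * s)) * norm (u - v)"
  using assms(6-)
proof (induction k arbitrary: u v)
  case 0
  have "s \<ge> 0" using "0.prems"(1) norm_ge_zero order_trans by blast
  moreover have "K \<ge> 0" using K \<mu> C by simp
  ultimately show ?case by (simp add: mult_right_mono[of 1 "1 + K * s", simplified])
next
  case (Suc k)
  have s: "s \<ge> 0" using Suc.prems(1) norm_ge_zero order_trans by blast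
  have K0: "K \<ge> 0" using K \<mu> C by simp
  define T where "T = \<mu> ^ k * s"
  have T0: "T \<ge> 0" using s \<mu> by (simp add: T_def)
  have TS: "\<mu> ^ Suc k * s = \<mu> * T" by (simp add: T_def)
  have TT: "T \<le> \<mu> * T" using T0 \<mu> by (simp add: mult_le_cancel_right1)
  have KT: "K * T \<le> 1"
    using Suc.prems(3) mult_left_mono[OF TT K0] unfolding TS by linarith
  have T\<rho>: "2 * T \<le> \<rho>" using Suc.prems(4) TT unfolding TS by linarith
  have IH: "norm ((F ^^ k) u - (F ^^ k) v) \<le> \<mu> ^ k * (1 + K * T) * norm (u - v)"
    if "norm u \<le> s" "norm v \<le> s" for u v
    unfolding T_def using Suc.IH[of u v] that KT T\<rho> by (simp add: T_def)
  have F0': "(F ^^ k) 0 = 0" by (induction k) (use F0 in auto)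
  have bd: "norm ((F ^^ k) w) \<le> 2 * T" if "norm w \<le> s" for w
  proof -
    have "norm ((F ^^ k) w) \<le> \<mu> ^ k * (1 + K * T) * norm w"
      using IH[of w 0] that s F0' by simp
    also have "\<dots> \<le> \<mu> ^ k * 2 * s"
      using that KT T0 K0 \<mu> by (intro mult_mono) auto
    finally show ?thesis by (simp add: T_def mult_ac)
  qed
  \<comment> \<open>By \<open>bd\<close> both \<open>k\<close>-th iterates lie in the disc of radius
    \<open>2 * T\<close>, so \<open>lip\<close> applies with \<open>t = 2 * T\<close>.\<close>
  have "norm ((F ^^ Suc k) u - (F ^^ Suc k) v) \<le> (\<mu> + C * (2 * T)) * norm ((F ^^ k) u - (F ^^ k) v)"
    using lip[OF T\<rho> bd bd] Suc.prems by simp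
  also have "\<dots> \<le> (\<mu> + C * (2 * T)) * (\<mu> ^ k * (1 + K * T) * norm (u - v))"
    using IH Suc.prems \<mu> C T0 by (intro mult_left_mono) auto
  also have "\<dots> = \<mu> ^ k * ((\<mu> + C * (2 * T)) * (1 + K * T)) * norm (u - v)"
    by simp
  also have "\<dots> \<le> \<mu> ^ k * (\<mu> * (1 + K * (\<mu> * T))) * norm (u - v)"
  proof (intro mult_right_mono mult_left_mono)
    \<comment> \<open>Replacing \<open>1 + K * T\<close> by 2 turns the excess into
      \<open>4 * C * T\<close>, and \<open>K\<close> is chosen so that this is exactly
      \<open>\<mu> * (K * (\<mu> - 1) * T)\<close>.\<close>
    have "C * (2 * T) * (1 + K * T) \<le> C * (2 * T) * 2"
      using KT C T0 by (intro mult_left_mono) auto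
    also have "\<dots> = \<mu> * (K * (\<mu> - 1) * T)" 
    proof -
      have "K * \<mu> * (\<mu> - 1) = 4 * C" using K \<mu> by simp
      moreover have "\<mu> * (K * (\<mu> - 1) * T) = K * \<mu> * (\<mu> - 1) * T" by (simp only: mult_ac)
      ultimately have "\<mu> * (K * (\<mu> - 1) * T) = 4 * C * T" by metis
      then show ?thesis by linarith
    qed
    finally show "(\<mu> + C * (2 * T)) * (1 + K * T) \<le> \<mu> * (1 + K * (\<mu> * T))"
      by (simp add: algebra_simps)
  qed (use \<mu> in auto)
  finally show ?case by (simp add: T_def mult_ac)
qed

text \<open>The map \<open>F z - deriv F 0 * z\<close> has derivative
  \<open>deriv F z - deriv F 0\<close>, which is at most \<open>C * norm z\<close> once
  \<open>C\<close> bounds the second derivative on a closed disc inside the domain. The mean value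
  inequality on \<open>cball 0 t\<close> turns this into the Lipschitz constant
  \<open>C * t\<close>.\<close>

lemma lipschitz_near_fixpoint:
  fixes F :: "complex \<Rightarrow> complex"
  assumes hol: "F holomorphic_on ball 0 \<rho>0" and "\<rho>0 > 0"
  obtains \<rho> C where "0 < \<rho>" "\<rho> < \<rho>0" "C \<ge> 0"
    "\<And>t u v. t \<le> \<rho> \<Longrightarrow> norm u \<le> t \<Longrightarrow> norm v \<le> t \<Longrightarrow>
      norm ((F u - deriv F 0 * u) - (F v - deriv F 0 * v)) \<le> C * t * norm (u - v)"
proof -
  define \<rho> where "\<rho> = \<rho>0 / 2"
  have \<rho>: "0 < \<rho>" "\<rho> < \<rho>0" using assms by (auto simp: \<rho>_def)
  have sub: "cball 0 \<rho> \<subseteq> ball 0 \<rho>0" using \<rho> by auto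
  have hol': "deriv F holomorphic_on ball 0 \<rho>0" "deriv (deriv F) holomorphic_on ball 0 \<rho>0"
    using hol by (auto intro!: holomorphic_deriv)
  have "compact (deriv (deriv F) ` cball 0 \<rho>)"
    using hol'(2) sub by (intro compact_continuous_image)
      (auto intro: holomorphic_on_imp_continuous_on continuous_on_subset)
  then obtain C where C: "\<And>z. z \<in> cball 0 \<rho> \<Longrightarrow> norm (deriv (deriv F) z) \<le> C" "C > 0"
    unfolding compact_eq_bounded_closed bounded_pos by blast
  have D1: "norm (deriv F w - deriv F 0) \<le> C * norm w" if "norm w \<le> \<rho>" for w
  proof -
    have "norm (deriv F w - deriv F 0) \<le> C * norm (w - 0)"
    proof (rule field_differentiable_bound[of "cball 0 \<rho>" _ "deriv (deriv F)"])
      fix z :: complex assume "z \<in> cball 0 \<rho>"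
      then show "(deriv F has_field_derivative deriv (deriv F) z) (at z within cball 0 \<rho>)"
        using hol'(1) sub by (intro DERIV_subset[OF holomorphic_derivI]) auto
    qed (use C that \<rho> in auto)
    then show ?thesis by simp
  qed
  show ?thesis
  proof (rule that[of \<rho> C])
    fix t :: real and u v :: complex assume t: "t \<le> \<rho>" "norm u \<le> t" "norm v \<le> t"
    have "norm ((F u - deriv F 0 * u) - (F v - deriv F 0 * v)) \<le> (C * t) * norm (u - v)"
    proof (rule field_differentiable_bound[of "cball 0 t" _ "\<lambda>z. deriv F z - deriv F 0"])
      fix z :: complex assume z: "z \<in> cball 0 t"
      have "(F has_field_derivative deriv F z) (at z within cball 0 t)"
        using hol sub t z by (intro DERIV_subset[OF holomorphic_derivI]) auto
      then show "((\<lambda>z. F z - deriv F 0 * z) has_field_derivative deriv F z - deriv F 0) (at z within cball 0 t)"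
        by (auto intro!: derivative_eq_intros)
      have "norm (deriv F z - deriv F 0) \<le> C * norm z" using D1 z t by auto
      also have "\<dots> \<le> C * t" using z C by auto
      finally show "norm (deriv F z - deriv F 0) \<le> C * t" .
    qed (use t in auto)
    then show "norm ((F u - deriv F 0 * u) - (F v - deriv F 0 * v)) \<le> C * t * norm (u - v)" .
  qed (use \<rho> C in auto)
qed

text \<open>Koenigs linearization. With \<open>v = z / lam ^ Suc n\<close>, the approximants
  \<open>\<psi> (Suc n) z\<close> and \<open>\<psi> n z\<close> are the images under
  \<open>F ^^ n\<close> of \<open>F v\<close> and \<open>lam * v\<close>. These two points differ by
  a quantity of order \<open>1 / \<mu> ^ (2 * n)\<close>, while \<open>F ^^ n\<close> expands
  distances there by at most \<open>2 * \<mu> ^ n\<close>; hence the approximants converge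
  geometrically, and their properties pass to the limit.\<close>

lemma poincare_function_local:
  fixes F :: "complex \<Rightarrow> complex"
  assumes hol: "F holomorphic_on ball 0 \<rho>0" and \<rho>0: "\<rho>0 > 0" and F0: "F 0 = 0"
    and lam: "deriv F 0 = lam" "norm lam > 1"
  obtains r \<psi> where "r > 0" "\<psi> holomorphic_on ball 0 r" "\<psi> 0 = 0" "deriv \<psi> 0 = 1"
    "\<psi> ` ball 0 r \<subseteq> ball 0 \<rho>0"
    "\<And>z. norm (lam * z) < r \<Longrightarrow> \<psi> (lam * z) = F (\<psi> z)"
    "lam \<in> \<real> \<Longrightarrow> (\<And>x. x \<in> ball 0 \<rho>0 \<inter> \<real> \<Longrightarrow> F x \<in> \<real>) \<Longrightarrow> \<psi> ` (ball 0 r \<inter> \<real>) \<subseteq> \<real>"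
proof -
  define \<mu> where "\<mu> = norm lam"
  have \<mu>: "\<mu> > 1" using lam by (simp add: \<mu>_def)
  have lam0: "lam \<noteq> 0" using lam by auto
  obtain \<rho> C where \<rho>: "0 < \<rho>" "\<rho> < \<rho>0" and C: "C \<ge> 0"
    and E: "\<And>t u v. t \<le> \<rho> \<Longrightarrow> norm u \<le> t \<Longrightarrow> norm v \<le> t \<Longrightarrow>
      norm ((F u - lam * u) - (F v - lam * v)) \<le> C * t * norm (u - v)"
    using lipschitz_near_fixpoint[OF hol \<rho>0] lam(1) by metis
  have lip: "norm (F u - F v) \<le> (\<mu> + C * t) * norm (u - v)"
    if "t \<le> \<rho>" "norm u \<le> t" "norm v \<le> t" for t u v
  proof -
    have "F u - F v = lam * (u - v) + ((F u - lam * u) - (F v - lam * v))"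
      by (simp add: algebra_simps)
    then have "norm (F u - F v) \<le> norm (lam * (u - v)) + norm ((F u - lam * u) - (F v - lam * v))"
      by (metis norm_triangle_ineq)
    also have "\<dots> \<le> \<mu> * norm (u - v) + C * t * norm (u - v)"
      using E[OF that] by (simp add: norm_mult \<mu>_def)
    finally show ?thesis by (simp add: algebra_simps)
  qed
  define K where "K = 4 * C / (\<mu> * (\<mu> - 1))"
  have K: "K \<ge> 0" using \<mu> C by (simp add: K_def)
  \<comment> \<open>The bound \<open>4 * r \<le> \<rho>\<close> keeps the orbits in the disc where
    \<open>lip\<close> holds, \<open>C * r \<le> 1\<close> makes its constant at radius
    \<open>r\<close> at most \<open>2 * \<mu>\<close>, and \<open>2 * (K * r) \<le> 1\<close> makes
    the extra factor of \<open>iterate_lipschitz\<close> at most 2.\<close>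
  define r where "r = min (\<rho> / 4) (min (1 / (1 + C)) (1 / (2 * (1 + K))))"
  have r: "r > 0" "4 * r \<le> \<rho>" "C * r \<le> 1" "2 * (K * r) \<le> 1"
  proof -
    show "r > 0" using \<rho> C K by (simp add: r_def add_nonneg_pos)
    show "4 * r \<le> \<rho>" by (simp add: r_def)
    have "C * r \<le> C * (1 / (1 + C))" using C by (intro mult_left_mono) (auto simp: r_def)
    also have "\<dots> \<le> 1" using C by (simp add: field_simps)
    finally show "C * r \<le> 1" .
    have "K * r \<le> K * (1 / (2 * (1 + K)))" using K by (intro mult_left_mono) (auto simp: r_def)
    also have "\<dots> \<le> 1 / 2" using K by (simp add: field_simps)
    finally show "2 * (K * r) \<le> 1" by simp
  qed
  have Fn0: "(F ^^ n) 0 = 0" for n by (induction n) (use F0 in auto)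
  \<comment> \<open>The radius is \<open>2 * r / \<mu> ^ n\<close> rather than
    \<open>r / \<mu> ^ n\<close> because it must also admit the points \<open>F v\<close> with
    \<open>v = z / lam ^ Suc n\<close> that occur in \<open>step\<close>.\<close>
  have it: "norm ((F ^^ k) u - (F ^^ k) v) \<le> 2 * \<mu> ^ k * norm (u - v)"
    if "norm u \<le> 2 * r / \<mu> ^ n" "norm v \<le> 2 * r / \<mu> ^ n" "k \<le> n" for u v k n
  proof -
    have *: "\<mu> ^ k * (2 * r / \<mu> ^ n) \<le> 2 * r"
      using that(3) \<mu> r by (simp add: field_simps power_increasing)
    have "norm ((F ^^ k) u - (F ^^ k) v) \<le>
            \<mu> ^ k * (1 + K * (\<mu> ^ k * (2 * r / \<mu> ^ n))) * norm (u - v)"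
    proof (rule iterate_lipschitz[OF lip F0 \<mu> C K_def])
      show "K * (\<mu> ^ k * (2 * r / \<mu> ^ n)) \<le> 1"
        using mult_left_mono[OF * K] r by simp
    qed (use that * r in auto)
    also have "\<dots> \<le> \<mu> ^ k * 2 * norm (u - v)"
    proof (intro mult_right_mono mult_left_mono)
      have "K * (\<mu> ^ k * (2 * r / \<mu> ^ n)) \<le> 1" using mult_left_mono[OF * K] r by simp
      then show "1 + K * (\<mu> ^ k * (2 * r / \<mu> ^ n)) \<le> 2" by linarith
    qed (use \<mu> in auto)
    finally show ?thesis by (simp add: mult_ac)
  qed
  have small: "norm ((F ^^ k) u) \<le> 4 * r" if "norm u \<le> 2 * r / \<mu> ^ n" "k \<le> n" for u k n
  proof -
    have "norm ((F ^^ k) u) \<le> 2 * \<mu> ^ k * norm u"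
      using it[OF that(1) _ that(2), of 0] r \<mu> Fn0 by simp
    also have "\<dots> \<le> 2 * \<mu> ^ n * (2 * r / \<mu> ^ n)"
      using that \<mu> by (intro mult_mono power_increasing) auto
    finally show ?thesis using \<mu> by simp
  qed
  define \<psi> where "\<psi> = (\<lambda>n z. (F ^^ n) (z / lam ^ n))"
  have scale: "norm (z / lam ^ n) = norm z / \<mu> ^ n" for z n
    by (simp add: norm_divide norm_power \<mu>_def)
  have sc: "norm (z / lam ^ n) \<le> 2 * r / \<mu> ^ n" if "norm z \<le> 2 * r" for z n
    using that \<mu> unfolding scale by (intro divide_right_mono) auto
  \<comment> \<open>The induction is on \<open>k\<close> with \<open>n\<close> fixed: for
    \<open>k \<le> n\<close> the intermediate iterates stay in the domain of \<open>F\<close> by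
    \<open>small\<close>, so each further composition is legitimate.\<close>
  have holk: "(\<lambda>z. (F ^^ k) (z / lam ^ n)) holomorphic_on ball 0 r" if "k \<le> n" for k n
    using that
  proof (induction k)
    case 0
    then show ?case using lam0 by (auto intro!: holomorphic_intros)
  next
    case (Suc k)
    have "(F \<circ> (\<lambda>z. (F ^^ k) (z / lam ^ n))) holomorphic_on ball 0 r"
    proof (rule holomorphic_on_compose_gen[OF _ hol])
      show "(\<lambda>z. (F ^^ k) (z / lam ^ n)) ` ball 0 r \<subseteq> ball 0 \<rho>0"
      proof (intro image_subsetI)
        fix z :: complex assume "z \<in> ball 0 r"
        then show "(F ^^ k) (z / lam ^ n) \<in> ball 0 \<rho>0"
          using small[OF sc, of z k n] Suc.prems r \<rho> by simp
      qed
    qed (use Suc in auto)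
    then show ?case by (simp add: o_def)
  qed
  have hol\<psi>: "\<psi> n holomorphic_on ball 0 r" for n
    unfolding \<psi>_def by (rule holk) simp
  have step: "norm (\<psi> (Suc n) z - \<psi> n z) \<le> (2 * C * r\<^sup>2) * (1 / \<mu>) ^ n" if "norm z \<le> r" for n z
  proof -
    define v where "v = z / lam ^ Suc n"
    have nv: "norm v \<le> r / \<mu> ^ Suc n"
      unfolding v_def scale using that \<mu> by (intro divide_right_mono) auto
    also have "\<dots> \<le> r" using r \<mu> by (simp add: field_simps mult_le_cancel_left1 one_le_power mult_ge1_I)
    finally have nvr: "norm v \<le> r" .
    have lv: "lam * v = z / lam ^ n" using lam0 by (simp add: v_def)
    have "norm (F v) \<le> (\<mu> + C * r) * norm v"
      using lip[of r v 0] nvr r F0 by simp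
    also have "\<dots> \<le> (2 * \<mu>) * (r / \<mu> ^ Suc n)"
      using nv r \<mu> by (intro mult_mono) auto
    also have "\<dots> = 2 * r / \<mu> ^ n" using \<mu> by simp
    finally have nFv: "norm (F v) \<le> 2 * r / \<mu> ^ n" .
    \<comment> \<open>Taking \<open>t = norm v\<close> in \<open>E\<close> makes the error quadratic
      in \<open>v\<close>; the square of \<open>1 / \<mu> ^ Suc n\<close> outweighs the expansion
      \<open>2 * \<mu> ^ n\<close> of the remaining iterates.\<close>
    have "norm (F v - lam * v) \<le> C * norm v * norm v"
      using E[of "norm v" v 0] nvr r F0 by simp
    also have "\<dots> \<le> C * (r / \<mu> ^ Suc n) * (r / \<mu> ^ Suc n)"
      using nv C \<mu> r by (intro mult_mono) auto
    finally have nd: "norm (F v - lam * v) \<le> C * (r / \<mu> ^ Suc n) * (r / \<mu> ^ Suc n)" .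
    have "\<psi> (Suc n) z = (F ^^ n) (F v)"
      unfolding \<psi>_def v_def by (simp only: funpow_Suc_right o_apply)
    moreover have "\<psi> n z = (F ^^ n) (lam * v)" by (simp add: \<psi>_def lv)
    ultimately have "norm (\<psi> (Suc n) z - \<psi> n z) \<le> 2 * \<mu> ^ n * norm (F v - lam * v)"
      using it[OF nFv, of "lam * v" n] sc[of z n] that r lv by simp
    also have "\<dots> \<le> 2 * \<mu> ^ n * (C * (r / \<mu> ^ Suc n) * (r / \<mu> ^ Suc n))"
      using nd \<mu> by (intro mult_left_mono) auto
    also have "\<dots> = (2 * C * r\<^sup>2) * (1 / \<mu>) ^ n / (\<mu> * \<mu>)"
      using \<mu> by (simp add: field_simps power2_eq_square)
    also have "\<dots> \<le> (2 * C * r\<^sup>2) * (1 / \<mu>) ^ n"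
    proof -
      have "(2 * C * r\<^sup>2) * (1 / \<mu>) ^ n / (\<mu> * \<mu>) \<le> (2 * C * r\<^sup>2) * (1 / \<mu>) ^ n / 1"
        using \<mu> C by (intro divide_left_mono) (auto simp: mult_ge1_I)
      then show ?thesis by simp
    qed
    finally show ?thesis .
  qed
  \<comment> \<open>The approximants are the partial sums of their telescoping series, starting from
    \<open>\<psi> 0 z = z\<close>, so the geometric bound makes them converge uniformly.\<close>
  have "uniform_limit (ball 0 r) (\<lambda>n z. \<Sum>i<n. \<psi> (Suc i) z - \<psi> i z)
          (\<lambda>z. suminf (\<lambda>i. \<psi> (Suc i) z - \<psi> i z)) sequentially"
    using \<mu> by (intro Weierstrass_m_test[of _ _ "\<lambda>n. (2 * C * r\<^sup>2) * (1 / \<mu>) ^ n"])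
      (auto intro!: step summable_mult summable_geometric)
  moreover have "(\<Sum>i<n. \<psi> (Suc i) z - \<psi> i z) = \<psi> n z - z" for n z
    by (subst sum_lessThan_telescope) (simp add: \<psi>_def)
  ultimately have ul0: "uniform_limit (ball 0 r) (\<lambda>n z. \<psi> n z - z)
          (\<lambda>z. suminf (\<lambda>i. \<psi> (Suc i) z - \<psi> i z)) sequentially" by simp
  define \<Psi> where "\<Psi> = (\<lambda>z. suminf (\<lambda>i. \<psi> (Suc i) z - \<psi> i z) + z)"
  have ul: "uniform_limit (ball 0 r) \<psi> \<Psi> sequentially"
    using uniform_limit_add[OF ul0 uniform_limit_const[of "\<lambda>z. z"]]
    by (simp add: \<Psi>_def)
  have lim: "(\<lambda>n. \<psi> n z) \<longlonglongrightarrow> \<Psi> z" if "norm z < r" for z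
    using tendsto_uniform_limitI[OF ul, of z] that by simp
  have bound: "norm (\<Psi> z) \<le> \<rho>" if "norm z < r" for z
  proof (rule LIMSEQ_le_const2[OF tendsto_norm[OF lim[OF that]]], intro exI allI impI)
    fix n show "norm (\<psi> n z) \<le> \<rho>"
      unfolding \<psi>_def using small[OF sc, of z n n] that r by simp
  qed
  show ?thesis
  proof (rule that[of r \<Psi>])
    show "r > 0" by fact
    show "\<Psi> holomorphic_on ball 0 r"
    proof (rule holomorphic_uniform_sequence[OF open_ball hol\<psi>])
      fix x :: complex assume "x \<in> ball 0 r"
      then obtain d where "d > 0" "cball x d \<subseteq> ball 0 r"
        by (meson open_ball open_contains_cball)
      then show "\<exists>d>0. cball x d \<subseteq> ball 0 r \<and> uniform_limit (cball x d) \<psi> \<Psi> sequentially"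
        using uniform_limit_on_subset[OF ul] by blast
    qed
    show "\<Psi> 0 = 0"
      using LIMSEQ_unique[OF lim[of 0], of 0] r by (simp add: \<psi>_def Fn0)
    show "\<Psi> ` ball 0 r \<subseteq> ball 0 \<rho>0" using bound \<rho> by force
    \<comment> \<open>Derivatives of holomorphic functions converge along with the functions, and
      every approximant has derivative \<open>lam ^ n / lam ^ n = 1\<close> at 0.\<close>
    have "(\<lambda>n. deriv (\<psi> n) 0) \<longlonglongrightarrow> deriv \<Psi> 0"
      using deriv_complex_uniform_limit[OF ul _ _ open_ball, of 0] hol\<psi> r by simp
    moreover have "deriv (\<psi> n) 0 = 1" for n
    proof -
      have Fd: "(F has_field_derivative lam) (at 0)"
        using holomorphic_derivI[OF hol open_ball, of 0] lam(1) \<rho>0 by simp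
      have "((F ^^ k) has_field_derivative lam ^ k) (at 0)" for k
      proof (induction k)
        case 0
        then show ?case by (simp add: id_def)
      next
        case (Suc k)
        show ?case
          using DERIV_chain[of F lam "F ^^ k" 0 "lam ^ k"] Suc Fd Fn0 by (simp add: o_def)
      qed
      then have "((F ^^ n) has_field_derivative lam ^ n) (at (0 / lam ^ n))" by simp
      then have "(((F ^^ n) \<circ> (\<lambda>z. z / lam ^ n)) has_field_derivative lam ^ n * (1 / lam ^ n)) (at 0)"
        by (intro DERIV_chain DERIV_cdivide DERIV_ident)
      then show ?thesis unfolding \<psi>_def using lam0 by (simp add: DERIV_imp_deriv o_def)
    qed
    ultimately show "deriv \<Psi> 0 = 1" by (simp add: LIMSEQ_const_iff)
    fix z assume z: "norm (lam * z) < r"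
    have "norm z \<le> norm (lam * z)" using lam by (simp add: norm_mult mult_le_cancel_right1)
    then have z': "norm z < r" using z by simp
    have lim1: "(\<lambda>n. F (\<psi> n z)) \<longlonglongrightarrow> F (\<Psi> z)"
    proof (rule isCont_tendsto_compose[OF _ lim[OF z']])
      show "isCont F (\<Psi> z)"
        using bound[OF z'] \<rho> holomorphic_on_imp_continuous_on[OF hol]
        by (auto simp: continuous_on_eq_continuous_at)
    qed
    \<comment> \<open>The functional equation holds exactly between consecutive approximants; the
      index shift disappears in the limit.\<close>
    have "F (\<psi> n z) = \<psi> (Suc n) (lam * z)" for n
      using lam0 by (simp add: \<psi>_def)
    then have "(\<lambda>n. F (\<psi> n z)) \<longlonglongrightarrow> \<Psi> (lam * z)"
      using LIMSEQ_Suc[OF lim[OF z]] by simp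
    then show "\<Psi> (lam * z) = F (\<Psi> z)" using lim1 by (rule LIMSEQ_unique)
  next
    assume lamR: "lam \<in> \<real>" and FR: "\<And>x. x \<in> ball 0 \<rho>0 \<inter> \<real> \<Longrightarrow> F x \<in> \<real>"
    show "\<Psi> ` (ball 0 r \<inter> \<real>) \<subseteq> \<real>"
    proof clarify
      fix x :: complex assume x: "x \<in> ball 0 r" "x \<in> \<real>"
      have "(F ^^ k) (x / lam ^ n) \<in> \<real>" if "k \<le> n" for k n
        using that
      proof (induction k)
        case 0
        then show ?case using x lamR by simp
      next
        case (Suc k)
        have "norm ((F ^^ k) (x / lam ^ n)) \<le> 4 * r"
          using small[OF sc, of x k n] Suc.prems x r by simp
        then show ?case using Suc FR[of "(F ^^ k) (x / lam ^ n)"] r \<rho> by simp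
      qed
      then show "\<Psi> x \<in> \<real>"
        using closed_sequentially[OF closed_complex_Reals _ lim[of x]] x by (simp add: \<psi>_def)
    qed
  qed
qed

subsection \<open>Holomorphic maps between Riemann surfaces\<close>

lemma chart_facts:
  assumes "riemann_surface S" "(U, \<phi>) \<in> atlas S"
  shows chart_openin: "openin (stop S) U"
    and chart_subset: "U \<subseteq> points S"
    and chart_inj: "inj_on \<phi> U"
    and chart_open_image: "openin (stop S) W \<Longrightarrow> W \<subseteq> U \<Longrightarrow> open (\<phi> ` W)"
    and chart_openin_preimage: "open N \<Longrightarrow> openin (stop S) (U \<inter> \<phi> -` N)"
proof -
  have U: "openin (stop S) U" and op: "open (\<phi> ` U)"
    and hom: "homeomorphic_map (subtopology (stop S) U) (top_of_set (\<phi> ` U)) \<phi>"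
    using assms unfolding riemann_surface_def by fastforce+
  show "openin (stop S) U" by fact
  show sub: "U \<subseteq> points S" using U openin_subset by auto
  then have ts: "topspace (subtopology (stop S) U) = U" by auto
  show "inj_on \<phi> U" using homeomorphic_imp_injective_map[OF hom] ts by simp
  show "open (\<phi> ` W)" if "openin (stop S) W" "W \<subseteq> U"
  proof -
    have "openin (subtopology (stop S) U) W"
      using that by (meson openin_subset_topspace_eq openin_subtopology subset_openin_subtopology)
    then have "openin (top_of_set (\<phi> ` U)) (\<phi> ` W)"
      using homeomorphic_imp_open_map[OF hom] by (auto simp: open_map_def)
    then show ?thesis using op openin_open_trans by blast
  qed
  show "openin (stop S) (U \<inter> \<phi> -` N)" if "open N"
  proof -
    have "continuous_map (subtopology (stop S) U) euclidean \<phi>"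
      using homeomorphic_imp_continuous_map[OF hom] continuous_map_in_subtopology by blast
    then have "openin (subtopology (stop S) U) {x \<in> U. \<phi> x \<in> N}"
      using openin_continuous_map_preimage[of "subtopology (stop S) U" euclidean \<phi> N] that
      unfolding ts by simp
    moreover have "{x \<in> U. \<phi> x \<in> N} = U \<inter> \<phi> -` N" by auto
    ultimately show ?thesis using U openin_trans_full by auto
  qed
qed

lemma chart_at:
  assumes "riemann_surface S" "x \<in> points S"
  obtains U \<phi> where "(U, \<phi>) \<in> atlas S" "x \<in> U"
  using assms unfolding riemann_surface_def by blast

lemma chart_image_mem:
  assumes "riemann_surface S" "(U, \<phi>) \<in> atlas S" "h ` inv_into U \<phi> ` N \<subseteq> V" "y \<in> U" "\<phi> y \<in> N"
  shows "h y \<in> V"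
proof -
  have "h (inv_into U \<phi> (\<phi> y)) \<in> V" using assms(3,5) by blast
  then show ?thesis using chart_inj[OF assms(1,2)] assms(4) by simp
qed

lemma transition_holomorphic:
  assumes "riemann_surface S" "(U, \<phi>) \<in> atlas S" "(V, \<psi>) \<in> atlas S"
  shows "(\<psi> \<circ> inv_into U \<phi>) holomorphic_on (\<phi> ` (U \<inter> V))"
  using assms unfolding riemann_surface_def by fast

lemma holomorphic_on_local:
  assumes "\<And>z. z \<in> D \<Longrightarrow> \<exists>N. open N \<and> z \<in> N \<and> f holomorphic_on N"
  shows "f holomorphic_on D"
  unfolding holomorphic_on_def
proof
  fix z assume "z \<in> D"
  then obtain N where "open N" "z \<in> N" "f holomorphic_on N" using assms by blast
  then show "f field_differentiable (at z within D)"
    using field_differentiable_at_within holomorphic_on_imp_differentiable_at by blast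
qed

text \<open>A pointwise notion that asks for one suitable pair of charts instead of all pairs. The
  requirement that \<open>h\<close> maps the coordinate neighbourhood into \<open>V\<close> is what
  makes continuity a consequence.\<close>

definition holo_at :: "'a surface \<Rightarrow> 'b surface \<Rightarrow> ('a \<Rightarrow> 'b) \<Rightarrow> 'a \<Rightarrow> bool" where
  "holo_at S T h x \<longleftrightarrow>
     (\<exists>U \<phi> V \<psi> N. (U, \<phi>) \<in> atlas S \<and> (V, \<psi>) \<in> atlas T \<and> x \<in> U \<and> open N \<and> \<phi> x \<in> N \<and>
        N \<subseteq> \<phi> ` U \<and> h ` inv_into U \<phi> ` N \<subseteq> V \<and> (\<psi> \<circ> h \<circ> inv_into U \<phi>) holomorphic_on N)"

text \<open>Coordinate expressions of \<open>h\<close> are defined on such sets. The set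
  \<open>W\<close> leaves room for a further restriction, such as to the domain of another
  chart.\<close>

lemma chart_domain_open:
  assumes "riemann_surface S" "riemann_surface T" "continuous_map (stop S) (stop T) h"
    and "(U, \<phi>) \<in> atlas S" "(V, \<psi>) \<in> atlas T" "openin (stop S) W"
  shows "open (\<phi> ` (U \<inter> h -` V \<inter> W))"
proof (rule chart_open_image[OF assms(1,4)])
  have "openin (stop S) {x \<in> points S. h x \<in> V}"
    using openin_continuous_map_preimage[OF assms(3)] chart_openin[OF assms(2,5)] by simp
  then have "openin (stop S) (U \<inter> {x \<in> points S. h x \<in> V} \<inter> W)"
    using chart_openin[OF assms(1,4)] assms(6) by blast
  moreover have "U \<inter> {x \<in> points S. h x \<in> V} \<inter> W = U \<inter> h -` V \<inter> W"
    using chart_subset[OF assms(1,4)] by auto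
  ultimately show "openin (stop S) (U \<inter> h -` V \<inter> W)" by simp
qed auto

lemma holomorphic_map_imp_holo_at:
  assumes S: "riemann_surface S" and T: "riemann_surface T" and h: "holomorphic_map S T h"
    and x: "x \<in> points S"
  shows "holo_at S T h x"
proof -
  have cont: "continuous_map (stop S) (stop T) h" using h by (simp add: holomorphic_map_def)
  obtain U \<phi> where U: "(U, \<phi>) \<in> atlas S" "x \<in> U" using chart_at[OF S x] .
  have "h x \<in> points T" using cont x continuous_map_image_subset_topspace by fastforce
  then obtain V \<psi> where V: "(V, \<psi>) \<in> atlas T" "h x \<in> V" using chart_at[OF T] by blast
  have "U \<inter> h -` V \<inter> U = U \<inter> h -` V" by blast
  then have "open (\<phi> ` (U \<inter> h -` V))"
    using chart_domain_open[OF S T cont U(1) V(1) chart_openin[OF S U(1)]] by simp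
  moreover have "h ` inv_into U \<phi> ` (\<phi> ` (U \<inter> h -` V)) \<subseteq> V"
    using chart_inj[OF S U(1)] by auto
  moreover have "(\<psi> \<circ> h \<circ> inv_into U \<phi>) holomorphic_on (\<phi> ` (U \<inter> h -` V))"
    using h U V unfolding holomorphic_map_def by fast
  ultimately show ?thesis unfolding holo_at_def using U V by blast
qed

text \<open>One good pair of charts at each point suffices: it gives continuity there, and the
  expression of \<open>h\<close> in any other pair arises by composing with holomorphic transition
  maps on both sides.\<close>

lemma holomorphic_map_if_holo_at:
  assumes S: "riemann_surface S" and T: "riemann_surface T"
    and loc: "\<And>x. x \<in> points S \<Longrightarrow> holo_at S T h x"
  shows "holomorphic_map S T h"
proof -
  have "topcontinuous_at (stop S) (stop T) h x" if x: "x \<in> points S" for x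
    unfolding topcontinuous_at_def
  proof (intro conjI allI impI)
    have "h y \<in> points T" if "y \<in> points S" for y
    proof -
      obtain U \<phi> V \<psi> N where *: "(U, \<phi>) \<in> atlas S" "(V, \<psi>) \<in> atlas T" "y \<in> U" "\<phi> y \<in> N"
          "h ` inv_into U \<phi> ` N \<subseteq> V"
        using loc[of y] \<open>y \<in> points S\<close> unfolding holo_at_def by blast
      then have "h y \<in> V" using chart_image_mem[OF S] by blast
      then show ?thesis using chart_subset[OF T *(2)] by auto
    qed
    then show "h \<in> points S \<rightarrow> points T" by auto
  next
    fix W assume W: "openin (stop T) W \<and> h x \<in> W"
    obtain U \<phi> V \<psi> N where U: "(U, \<phi>) \<in> atlas S" "x \<in> U" and V: "(V, \<psi>) \<in> atlas T"
      and N: "open N" "\<phi> x \<in> N" "h ` inv_into U \<phi> ` N \<subseteq> V"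
        "(\<psi> \<circ> h \<circ> inv_into U \<phi>) holomorphic_on N"
      using loc[OF x] unfolding holo_at_def by blast
    have hV: "h y \<in> V" "inv_into U \<phi> (\<phi> y) = y" if "y \<in> U" "\<phi> y \<in> N" for y
      using that chart_image_mem[OF S U(1) N(3)] chart_inj[OF S U(1)] by auto
    have op: "open (\<psi> ` (V \<inter> W))"
      using chart_open_image[OF T V] chart_openin[OF T V] W by (meson inf_le1 openin_Int)
    have "open (N \<inter> (\<psi> \<circ> h \<circ> inv_into U \<phi>) -` (\<psi> ` (V \<inter> W)))"
      using continuous_open_preimage[OF holomorphic_on_imp_continuous_on[OF N(4)] N(1) op] .
    note chart_openin_preimage[OF S U(1) this]
    moreover have "x \<in> U \<inter> \<phi> -` (N \<inter> (\<psi> \<circ> h \<circ> inv_into U \<phi>) -` (\<psi> ` (V \<inter> W)))"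
      using U N hV[of x] W by auto
    moreover have "h y \<in> W" if y: "y \<in> U \<inter> \<phi> -` (N \<inter> (\<psi> \<circ> h \<circ> inv_into U \<phi>) -` (\<psi> ` (V \<inter> W)))" for y
    proof -
      have "\<psi> (h y) \<in> \<psi> ` (V \<inter> W)" "h y \<in> V" using y hV[of y] by auto
      then show ?thesis using chart_inj[OF T V] by (metis IntE image_iff inj_onD)
    qed
    ultimately show "\<exists>M. openin (stop S) M \<and> x \<in> M \<and> (\<forall>y\<in>M. h y \<in> W)" by blast
  qed (use x in auto)
  then have cont: "continuous_map (stop S) (stop T) h"
    by (simp add: continuous_map_eq_topcontinuous_at)
  have "(\<psi>' \<circ> h \<circ> inv_into U' \<phi>') holomorphic_on (\<phi>' ` (U' \<inter> h -` V'))"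
    if U': "(U', \<phi>') \<in> atlas S" and V': "(V', \<psi>') \<in> atlas T" for U' \<phi>' V' \<psi>'
  proof (rule holomorphic_on_local)
    fix z assume "z \<in> \<phi>' ` (U' \<inter> h -` V')"
    then obtain x where x: "x \<in> U'" "h x \<in> V'" "z = \<phi>' x" by auto
    then have "x \<in> points S" using chart_subset[OF S U'] by auto
    then obtain U \<phi> V \<psi> N where U: "(U, \<phi>) \<in> atlas S" "x \<in> U" and V: "(V, \<psi>) \<in> atlas T"
      and N: "open N" "\<phi> x \<in> N" "h ` inv_into U \<phi> ` N \<subseteq> V"
        "(\<psi> \<circ> h \<circ> inv_into U \<phi>) holomorphic_on N"
      using loc unfolding holo_at_def by blast
    have hV: "h y \<in> V" "inv_into U \<phi> (\<phi> y) = y" if "y \<in> U" "\<phi> y \<in> N" for y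
      using that chart_image_mem[OF S U(1) N(3)] chart_inj[OF S U(1)] by auto
    \<comment> \<open>On \<open>M\<close> both pairs of charts apply, so the primed expression
      factors as transition, good expression, transition.\<close>
    define M where "M = U' \<inter> h -` V' \<inter> (U \<inter> \<phi> -` N)"
    have "open (\<phi>' ` M)"
      unfolding M_def using chart_domain_open[OF S T cont U' V'] chart_openin_preimage[OF S U(1) N(1)] by blast
    moreover have "z \<in> \<phi>' ` M" using x U N by (auto simp: M_def)
    moreover have "((\<psi>' \<circ> inv_into V \<psi>) \<circ> ((\<psi> \<circ> h \<circ> inv_into U \<phi>) \<circ> (\<phi> \<circ> inv_into U' \<phi>'))) holomorphic_on \<phi>' ` M"
    proof (rule holomorphic_on_compose_gen[OF holomorphic_on_compose_gen])
      show "(\<phi> \<circ> inv_into U' \<phi>') holomorphic_on \<phi>' ` M"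
        by (rule holomorphic_on_subset[OF transition_holomorphic[OF S U' U(1)]]) (auto simp: M_def)
      show "(\<psi>' \<circ> inv_into V \<psi>) holomorphic_on \<psi> ` (V \<inter> V')"
        by (rule transition_holomorphic[OF T V V'])
      show "(\<phi> \<circ> inv_into U' \<phi>') ` \<phi>' ` M \<subseteq> N"
        using chart_inj[OF S U'] by (auto simp: M_def)
      show "(\<psi> \<circ> h \<circ> inv_into U \<phi> \<circ> (\<phi> \<circ> inv_into U' \<phi>')) ` \<phi>' ` M \<subseteq> \<psi> ` (V \<inter> V')"
        using chart_inj[OF S U'] hV by (auto simp: M_def)
    qed (rule N)
    moreover have "((\<psi>' \<circ> inv_into V \<psi>) \<circ> ((\<psi> \<circ> h \<circ> inv_into U \<phi>) \<circ> (\<phi> \<circ> inv_into U' \<phi>'))) w =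
        (\<psi>' \<circ> h \<circ> inv_into U' \<phi>') w" if "w \<in> \<phi>' ` M" for w
      using that chart_inj[OF S U'] chart_inj[OF T V] hV by (auto simp: M_def)
    ultimately show "\<exists>N. open N \<and> z \<in> N \<and> (\<psi>' \<circ> h \<circ> inv_into U' \<phi>') holomorphic_on N"
      using holomorphic_cong by (metis (no_types, lifting))
  qed
  then show ?thesis using cont unfolding holomorphic_map_def by blast
qed

lemma holomorphic_map_compose:
  assumes S: "riemann_surface S" and T: "riemann_surface T" and R: "riemann_surface R"
    and h: "holomorphic_map S T h" and k: "holomorphic_map T R k"
  shows "holomorphic_map S R (k \<circ> h)"
proof (rule holomorphic_map_if_holo_at[OF S R])
  have ch: "continuous_map (stop S) (stop T) h" using h by (simp add: holomorphic_map_def)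
  have ck: "continuous_map (stop T) (stop R) k" using k by (simp add: holomorphic_map_def)
  have ckh: "continuous_map (stop S) (stop R) (k \<circ> h)" using ch ck by (rule continuous_map_compose)
  fix x assume x: "x \<in> points S"
  have hx: "h x \<in> points T" and khx: "k (h x) \<in> points R"
    using x ch ckh continuous_map_image_subset_topspace by fastforce+
  obtain U \<phi> where U: "(U, \<phi>) \<in> atlas S" "x \<in> U" using chart_at[OF S x] .
  obtain V \<psi> where V: "(V, \<psi>) \<in> atlas T" "h x \<in> V" using chart_at[OF T hx] .
  obtain W \<kappa> where W: "(W, \<kappa>) \<in> atlas R" "k (h x) \<in> W" using chart_at[OF R khx] .
  define M where "M = U \<inter> h -` V \<inter> (k \<circ> h) -` W"
  have "openin (stop S) {x \<in> points S. (k \<circ> h) x \<in> W}"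
    using openin_continuous_map_preimage[OF ckh] chart_openin[OF R W(1)] by simp
  then have "open (\<phi> ` (U \<inter> h -` V \<inter> {x \<in> points S. (k \<circ> h) x \<in> W}))"
    by (rule chart_domain_open[OF S T ch U(1) V(1)])
  moreover have "U \<inter> h -` V \<inter> {x \<in> points S. (k \<circ> h) x \<in> W} = M"
    using chart_subset[OF S U(1)] by (auto simp: M_def)
  ultimately have op: "open (\<phi> ` M)" by simp
  have inv: "inv_into U \<phi> (\<phi> y) = y" if "y \<in> M" for y
    using that chart_inj[OF S U(1)] by (simp add: M_def)
  have "((\<kappa> \<circ> k \<circ> inv_into V \<psi>) \<circ> (\<psi> \<circ> h \<circ> inv_into U \<phi>)) holomorphic_on \<phi> ` M"
  proof (rule holomorphic_on_compose_gen)
    have "(\<psi> \<circ> h \<circ> inv_into U \<phi>) holomorphic_on \<phi> ` (U \<inter> h -` V)"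
      using h U V unfolding holomorphic_map_def by fast
    then show "(\<psi> \<circ> h \<circ> inv_into U \<phi>) holomorphic_on \<phi> ` M"
      by (rule holomorphic_on_subset) (auto simp: M_def)
    show "(\<kappa> \<circ> k \<circ> inv_into V \<psi>) holomorphic_on \<psi> ` (V \<inter> k -` W)"
      using k V W unfolding holomorphic_map_def by fast
    show "(\<psi> \<circ> h \<circ> inv_into U \<phi>) ` \<phi> ` M \<subseteq> \<psi> ` (V \<inter> k -` W)"
      using inv by (auto simp: M_def)
  qed
  moreover have "((\<kappa> \<circ> k \<circ> inv_into V \<psi>) \<circ> (\<psi> \<circ> h \<circ> inv_into U \<phi>)) w = (\<kappa> \<circ> (k \<circ> h) \<circ> inv_into U \<phi>) w"
    if "w \<in> \<phi> ` M" for w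
    using that inv chart_inj[OF T V(1)] by (auto simp: M_def)
  ultimately have "(\<kappa> \<circ> (k \<circ> h) \<circ> inv_into U \<phi>) holomorphic_on \<phi> ` M"
    using holomorphic_cong by (metis (no_types, lifting))
  moreover have "\<phi> x \<in> \<phi> ` M" "\<phi> ` M \<subseteq> \<phi> ` U" "(k \<circ> h) ` inv_into U \<phi> ` \<phi> ` M \<subseteq> W"
    using U V W inv by (auto simp: M_def)
  ultimately show "holo_at S R (k \<circ> h) x"
    unfolding holo_at_def using U W op by blast
qed

section \<open>Plane domains as Riemann surfaces\<close>

lemma atlas_planar [simp]: "atlas (planar_surface D) = {(D, \<lambda>z. z)}"
  and stop_planar [simp]: "stop (planar_surface D) = top_of_set D"
  by (simp_all add: planar_surface_def)

lemma inv_into_ident: "z \<in> D \<Longrightarrow> inv_into D (\<lambda>z. z) z = z"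
  by (metis image_ident inv_into_f_f inj_on_id2)

lemma riemann_surface_planar:
  assumes "open D" "connected D" "D \<noteq> {}"
  shows "riemann_surface (planar_surface D)"
proof -
  have "((\<lambda>z. z) \<circ> inv_into D (\<lambda>z. z)) holomorphic_on D"
    by (rule holomorphic_transform[of "\<lambda>z. z"]) (auto simp: inv_into_ident)
  then show ?thesis
    unfolding riemann_surface_def using assms
    by (auto simp: connected_space_subtopology Hausdorff_space_subtopology
        subtopology_subtopology homeomorphic_map_id[unfolded id_def] connectedin_iff_connected)
qed

lemma holomorphic_map_planar:
  assumes "f holomorphic_on D" "f ` D \<subseteq> E"
  shows "holomorphic_map (planar_surface D) (planar_surface E) f"
proof -
  have "((\<lambda>z. z) \<circ> f \<circ> inv_into D (\<lambda>z. z)) holomorphic_on D"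
    by (rule holomorphic_transform[OF assms(1)]) (auto simp: inv_into_ident)
  moreover have "continuous_map (top_of_set D) (top_of_set E) f"
    using assms by (auto simp: holomorphic_on_imp_continuous_on continuous_map_in_subtopology)
  ultimately show ?thesis
    unfolding holomorphic_map_def by (auto intro: holomorphic_on_subset)
qed

text \<open>With the identity chart eliminated, the domain enters only through
  \<open>N \<subseteq> D\<close>, so a witness for a smaller domain also serves a larger
  one.\<close>

lemma holo_at_planar_iff:
  assumes "open D"
  shows "holo_at (planar_surface D) T h x \<longleftrightarrow>
    (\<exists>V \<psi> N. (V, \<psi>) \<in> atlas T \<and> open N \<and> x \<in> N \<and> N \<subseteq> D \<and> h ` N \<subseteq> V \<and> (\<psi> \<circ> h) holomorphic_on N)"
proof -
  have "(\<psi> \<circ> h \<circ> inv_into D (\<lambda>z. z)) holomorphic_on N \<longleftrightarrow> (\<psi> \<circ> h) holomorphic_on N"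
    if "N \<subseteq> D" for N and \<psi> :: "'a \<Rightarrow> complex"
    using that by (intro holomorphic_cong) (auto simp: inv_into_ident)
  moreover have "inv_into D (\<lambda>z. z) ` N = N" if "N \<subseteq> D" for N
    using that inv_into_ident by force
  ultimately show ?thesis
    unfolding holo_at_def by (simp cong: conj_cong) blast
qed

text \<open>Meant for maps given by different formulas on different pieces: holomorphy at a point is
  witnessed inside the piece, hence inside the whole domain.\<close>

lemma holomorphic_map_glue:
  assumes D: "open D" "connected D" "D \<noteq> {}" and T: "riemann_surface T"
    and loc: "\<And>x. x \<in> D \<Longrightarrow> \<exists>E. open E \<and> connected E \<and> x \<in> E \<and> E \<subseteq> D \<and> holomorphic_map (planar_surface E) T h"
  shows "holomorphic_map (planar_surface D) T h"
proof (rule holomorphic_map_if_holo_at[OF riemann_surface_planar[OF D] T])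
  fix x assume "x \<in> points (planar_surface D)"
  then obtain E where E: "open E" "connected E" "x \<in> E" "E \<subseteq> D" "holomorphic_map (planar_surface E) T h"
    using loc by auto
  then have "holo_at (planar_surface E) T h x"
    using holomorphic_map_imp_holo_at[OF riemann_surface_planar T] by fastforce
  then show "holo_at (planar_surface D) T h x"
    unfolding holo_at_planar_iff[OF D(1)] holo_at_planar_iff[OF E(1)] using E(4) by blast
qed

lemma holo_at_chart:
  assumes "riemann_surface S" "(U, \<phi>) \<in> atlas S" "x \<in> U"
    and "holo_at (planar_surface (\<phi> ` U)) T (h \<circ> inv_into U \<phi>) (\<phi> x)"
  shows "holo_at S T h x"
proof -
  have "open (\<phi> ` U)" using chart_open_image[OF assms(1,2) chart_openin[OF assms(1,2)]] by simp
  then obtain V \<psi> N where N: "(V, \<psi>) \<in> atlas T" "open N" "\<phi> x \<in> N" "N \<subseteq> \<phi> ` U"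
    and "(h \<circ> inv_into U \<phi>) ` N \<subseteq> V"
     "(\<psi> \<circ> (h \<circ> inv_into U \<phi>)) holomorphic_on N"
    using assms(4) unfolding holo_at_planar_iff[OF \<open>open (\<phi> ` U)\<close>] by blast
  then have "h ` inv_into U \<phi> ` N \<subseteq> V" "(\<psi> \<circ> h \<circ> inv_into U \<phi>) holomorphic_on N"
    by (simp_all add: image_comp comp_assoc)
  then show ?thesis
    unfolding holo_at_def using assms(2,3) N by blast
qed

text \<open>The identity of the simply connected plane would lift through a covering
  \<open>p\<close> by the disc to an entire \<open>q\<close> with \<open>p (q y) = y\<close>. As
  \<open>q\<close> is bounded, it is constant by Liouville, which contradicts this equation.\<close>

lemma non_hyperbolic_plane: "non_hyperbolic (planar_surface UNIV)"
proof -
  have False if p: "holomorphic_covering (planar_surface (ball 0 1)) (planar_surface UNIV) p" for p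
  proof -
    have hol: "p holomorphic_on ball 0 1"
    proof -
      have "((\<lambda>z. z) \<circ> p \<circ> inv_into (ball 0 1) (\<lambda>z. z)) holomorphic_on ball 0 1"
        using p unfolding holomorphic_covering_def holomorphic_map_def by simp
      then show ?thesis
        by (rule holomorphic_transform) (auto simp: inv_into_ident simp del: mem_ball)
    qed
    have "covering_space (ball 0 1) p UNIV"
      unfolding covering_space_def
    proof (intro conjI ballI)
      show "continuous_on (ball 0 1) p" using hol by (rule holomorphic_on_imp_continuous_on)
      show "p ` ball 0 1 = UNIV" using p by (simp add: holomorphic_covering_def)
      fix x :: complex
      obtain V \<U> where V: "x \<in> V" "open V" and \<U>: "\<Union>\<U> = ball 0 1 \<inter> p -` V" "pairwise disjnt \<U>"
        and U: "\<And>U. U \<in> \<U> \<Longrightarrow> openin (top_of_set (ball 0 1)) U \<and>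
          homeomorphic_map (subtopology (top_of_set (ball 0 1)) U) (top_of_set V) p"
        using p unfolding holomorphic_covering_def by (simp add: Ball_def) metis
      \<comment> \<open>\<open>covering_space\<close> asks for an explicit inverse on each sheet. As
        the sheet lies in the disc, its iterated subspace topology collapses to
        \<open>top_of_set U\<close>.\<close>
      have "\<exists>q. homeomorphism U V p q" if "U \<in> \<U>" for U
      proof -
        have "U \<subseteq> ball 0 1" using U[OF that] openin_imp_subset by blast
        then have "homeomorphic_map (top_of_set U) (top_of_set V) p"
          using U[OF that] by (simp add: subtopology_subtopology inf.absorb2)
        then obtain q where "homeomorphic_maps (top_of_set U) (top_of_set V) p q"
          using homeomorphic_map_maps by blast
        then have "homeomorphism U V p q"
          by (intro homeomorphismI) (auto simp: homeomorphic_maps_def)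
        then show ?thesis by blast
      qed
      then show "\<exists>T. x \<in> T \<and> openin (top_of_set UNIV) T \<and>
          (\<exists>v. \<Union>v = ball 0 1 \<inter> p -` T \<and> (\<forall>u\<in>v. openin (top_of_set (ball 0 1)) u) \<and>
            pairwise disjnt v \<and> (\<forall>u\<in>v. \<exists>q. homeomorphism u T p q))"
        using V \<U> U by (intro exI[of _ V] conjI exI[of _ \<U>]) auto
    qed
    then obtain q where q: "q holomorphic_on UNIV" "q ` UNIV \<subseteq> ball 0 1" "\<And>y. p (q y) = y"
      using covering_space_lift_holomorphic[of "ball 0 1" p UNIV "\<lambda>z. z" UNIV] hol
        convex_imp_simply_connected[OF convex_UNIV] convex_imp_locally_path_connected[OF convex_UNIV]
      by (auto simp: Pi_iff image_subset_iff)
    have "bounded (range q)" using q(2) bounded_subset bounded_ball by blast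
    then obtain c where "\<And>z. q z = c" using Liouville_theorem q(1) by (metis constant_on_def UNIV_I)
    then have "(0::complex) = 1" using q(3) by metis
    then show False by simp
  qed
  then show ?thesis
    unfolding non_hyperbolic_def using riemann_surface_planar[of UNIV] by auto
qed

subsection \<open>The Riemann sphere\<close>

text \<open>The inverse of the chart \<open>recip_coord\<close>, total on the plane. Its values
  avoid \<open>Some 0\<close>, where the convention \<open>1 / 0 = 0\<close> gives
  \<open>recip_coord\<close> the same value as at \<open>None\<close>.\<close>

definition sphere_recip :: "complex \<Rightarrow> sphere_pt" where
  "sphere_recip w = (if w = 0 then None else Some (1 / w))"

lemma recip_coord_simps [simp]: "recip_coord None = 0" "recip_coord (Some z) = 1 / z"
  by (simp_all add: recip_coord_def)

lemma recip_coord_sphere_recip [simp]: "recip_coord (sphere_recip w) = w"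
  by (simp add: sphere_recip_def)

lemma sphere_recip_recip_coord: "x \<noteq> Some 0 \<Longrightarrow> sphere_recip (recip_coord x) = x"
  by (cases x) (auto simp: sphere_recip_def)

lemma sphere_recip_neq [simp]: "sphere_recip w \<noteq> Some 0"
  by (simp add: sphere_recip_def)

lemma atlas_sphere: "atlas riemann_sphere = {(range Some, the), (- {Some 0}, recip_coord)}"
  and stop_sphere: "stop riemann_sphere = Alexandroff_compactification euclidean"
  by (simp_all add: riemann_sphere_def)

lemma points_sphere [simp]: "points riemann_sphere = UNIV"
proof -
  have "x \<in> insert None (range Some)" for x :: sphere_pt by (cases x) auto
  then show ?thesis by (auto simp: stop_sphere)
qed

text \<open>Presents the one-point compactification as two planes glued by inversion, which reduces
  topological questions to plane sets. The delicate point is infinity: large \<open>z\<close>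
  correspond to \<open>w = 1 / z\<close> in a punctured disc around 0.\<close>

lemma openin_sphere_iff:
  "openin (stop riemann_sphere) A \<longleftrightarrow> open {z. Some z \<in> A} \<and> open {w. sphere_recip w \<in> A}"
  (is "_ \<longleftrightarrow> open ?P \<and> open ?Q")
proof
  assume "openin (stop riemann_sphere) A"
  then consider U where "open U" "A = Some ` U"
    | C where "compact C" "A = insert None (Some ` (- C))"
    by (auto simp: stop_sphere openin_Alexandroff_compactification compactin_euclidean_iff Compl_eq_Diff_UNIV)
  then show "open ?P \<and> open ?Q"
  proof cases
    case 1
    have "open (- {0} \<inter> (\<lambda>w::complex. 1 / w) -` U)"
      using 1(1) by (intro continuous_open_preimage) (auto intro!: continuous_intros)
    moreover have "?Q = - {0} \<inter> (\<lambda>w. 1 / w) -` U" "?P = U"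
      using 1(2) by (auto simp: sphere_recip_def)
    ultimately show ?thesis using 1 by simp
  next
    case 2
    then obtain B where B: "B > 0" "\<And>z. z \<in> C \<Longrightarrow> norm z \<le> B"
      using compact_imp_bounded bounded_pos by metis
    have "open (- C)" using 2(1) compact_imp_closed by blast
    then have "open (- {0} \<inter> (\<lambda>w::complex. 1 / w) -` (- C))"
      by (intro continuous_open_preimage) (auto intro!: continuous_intros)
    then have "open (ball 0 (1 / B) \<union> (- {0} \<inter> (\<lambda>w. 1 / w) -` (- C)))"
      by blast
    moreover have "?Q = ball 0 (1 / B) \<union> (- {0} \<inter> (\<lambda>w. 1 / w) -` (- C))"
    proof -
      have "1 / w \<notin> C" if "norm w < 1 / B" "w \<noteq> 0" for w
      proof
        assume "1 / w \<in> C"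
        then have "norm (1 / w) \<le> B" by (rule B(2))
        then show False using that B(1) by (simp add: norm_divide field_simps)
      qed
      then show ?thesis using 2(2) B(1) by (auto simp: sphere_recip_def image_iff)
    qed
    moreover have "?P = - C" using 2(2) by auto
    ultimately show ?thesis using \<open>open (- C)\<close> by simp
  qed
next
  assume op: "open ?P \<and> open ?Q"
  show "openin (stop riemann_sphere) A"
  proof (cases "None \<in> A")
    case False
    have "A = Some ` ?P"
    proof (rule set_eqI)
      fix x show "x \<in> A \<longleftrightarrow> x \<in> Some ` ?P" using False by (cases x) auto
    qed
    then show ?thesis
      using op unfolding stop_sphere openin_Alexandroff_compactification by auto
  next
    case True
    then have "0 \<in> ?Q" by (simp add: sphere_recip_def)
    then obtain e where e: "e > 0" "ball 0 e \<subseteq> ?Q" using op open_contains_ball by blast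
    \<comment> \<open>The disc of radius \<open>e\<close> around infinity puts all finite points of
      norm above \<open>1 / e\<close> into \<open>A\<close>; the missing finite points thus form a
      closed bounded, hence compact, set.\<close>
    have "norm z \<le> 1 / e" if "Some z \<notin> A" for z
    proof (rule ccontr)
      assume "\<not> norm z \<le> 1 / e"
      then have z: "norm z > 1 / e" by simp
      then have "norm z > 0" using e(1) by (meson divide_pos_pos less_trans zero_less_one)
      then have "1 / z \<in> ball 0 e" using z e(1) by (simp add: norm_divide field_simps)
      then show False using e(2) that \<open>norm z > 0\<close> by (auto simp: sphere_recip_def)
    qed
    then have "bounded (- ?P)" by (auto simp: bounded_iff)
    moreover have "closed (- ?P)" using op by (simp add: closed_Compl)
    ultimately have "compact (- ?P)" by (simp add: compact_eq_bounded_closed)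
    moreover have "A = insert None (Some ` (UNIV - (- ?P)))"
    proof (rule set_eqI)
      fix x show "x \<in> A \<longleftrightarrow> x \<in> insert None (Some ` (UNIV - (- ?P)))" using True by (cases x) auto
    qed
    ultimately show ?thesis
      unfolding stop_sphere openin_Alexandroff_compactification
      by (intro disjI2 exI[of _ "- ?P"]) (auto simp: compactin_euclidean_iff compact_imp_closed)
  qed
qed

lemma inv_into_the [simp]: "inv_into (range Some) the z = Some z"
  using inv_into_f_f[of the "range Some" "Some z"] by (auto simp: inj_on_def)

lemma inj_on_recip_coord: "inj_on recip_coord (- {Some 0})"
  by (metis ComplD inj_onI insertI1 sphere_recip_recip_coord)

lemma inv_into_recip_coord [simp]: "inv_into (- {Some 0}) recip_coord w = sphere_recip w"
  using inv_into_f_f[OF inj_on_recip_coord, of "sphere_recip w"] by simp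

lemma image_the [simp]: "the ` range Some = UNIV"
  by force

lemma image_recip_coord [simp]: "recip_coord ` (- {Some 0}) = UNIV"
proof -
  have "w \<in> recip_coord ` (- {Some 0})" for w
    by (rule image_eqI[of _ _ "sphere_recip w"]) auto
  then show ?thesis by auto
qed

lemma openin_sphere_charts:
  "openin (stop riemann_sphere) (range Some)" "openin (stop riemann_sphere) (- {Some 0})"
proof -
  have "{w. sphere_recip w \<in> range Some} = - {0}" by (auto simp: sphere_recip_def)
  moreover have "{z. Some z \<in> - {Some (0::complex)}} = - {0}" by auto
  ultimately show "openin (stop riemann_sphere) (range Some)" "openin (stop riemann_sphere) (- {Some 0})"
    by (simp_all add: openin_sphere_iff open_Compl)
qed

lemma sphere_chart_homeomorphic:
  "homeomorphic_map (subtopology (stop riemann_sphere) (range Some)) euclidean the"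
  "homeomorphic_map (subtopology (stop riemann_sphere) (- {Some 0})) euclidean recip_coord"
proof -
  have inv: "open (- {0} \<inter> (\<lambda>w::complex. 1 / w) -` W)" if "open W" for W
    using that by (intro continuous_open_preimage) (auto intro!: continuous_intros)
  have "openin (stop riemann_sphere) {x \<in> range Some. the x \<in> W}" if "open W" for W
  proof -
    have "{w. sphere_recip w \<in> {x \<in> range Some. the x \<in> W}} = - {0} \<inter> (\<lambda>w. 1 / w) -` W"
      by (auto simp: sphere_recip_def)
    then show ?thesis using inv[OF that] that by (simp add: openin_sphere_iff)
  qed
  then have "continuous_map (subtopology (stop riemann_sphere) (range Some)) euclidean the"
    unfolding continuous_map_openin_preimage_eq
    by (auto simp: openin_open_subtopology openin_sphere_charts Int_def vimage_def)
  moreover have "continuous_map euclidean (stop riemann_sphere) Some"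
    by (auto simp: continuous_map_def openin_sphere_iff)
  ultimately show "homeomorphic_map (subtopology (stop riemann_sphere) (range Some)) euclidean the"
    unfolding homeomorphic_map_maps homeomorphic_maps_def continuous_map_in_subtopology
    by (intro exI[of _ Some]) auto
  have "openin (stop riemann_sphere) {x \<in> - {Some 0}. recip_coord x \<in> W}" if "open W" for W
  proof -
    have "{z. Some z \<in> {x \<in> - {Some 0}. recip_coord x \<in> W}} = - {0} \<inter> (\<lambda>w. 1 / w) -` W"
      by auto
    then show ?thesis using inv[OF that] that by (simp add: openin_sphere_iff)
  qed
  then have "continuous_map (subtopology (stop riemann_sphere) (- {Some 0})) euclidean recip_coord"
    unfolding continuous_map_openin_preimage_eq
    by (auto simp: openin_open_subtopology openin_sphere_charts Int_def vimage_def)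
  moreover have "continuous_map euclidean (stop riemann_sphere) sphere_recip"
    by (auto simp: continuous_map_def openin_sphere_iff)
  ultimately show "homeomorphic_map (subtopology (stop riemann_sphere) (- {Some 0})) euclidean recip_coord"
    unfolding homeomorphic_map_maps homeomorphic_maps_def continuous_map_in_subtopology
    by (intro exI[of _ sphere_recip]) (auto simp: sphere_recip_recip_coord)
qed

lemma riemann_surface_sphere: "riemann_surface riemann_sphere"
proof -
  have cont: "continuous_map euclidean (stop riemann_sphere) Some"
    by (auto simp: continuous_map_def openin_sphere_iff)
  have "connectedin (stop riemann_sphere) (range Some)"
    using connectedin_continuous_map_image[OF cont, of UNIV] connected_UNIV
    by (simp only: connectedin_iff_connected)
  \<comment> \<open>Infinity is a limit of finite points, so the sphere is the closure of the
    connected set of finite points and therefore connected.\<close>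
  moreover have "stop riemann_sphere closure_of (range Some) = UNIV"
  proof -
    have "None \<in> stop riemann_sphere closure_of (range Some)"
      unfolding in_closure_of
    proof (intro conjI allI impI)
      fix T assume T: "None \<in> T \<and> openin (stop riemann_sphere) T"
      then have "open {w. sphere_recip w \<in> T}" "0 \<in> {w. sphere_recip w \<in> T}"
        by (auto simp: openin_sphere_iff sphere_recip_def)
      then obtain e where "e > 0" "ball 0 e \<subseteq> {w. sphere_recip w \<in> T}"
        using open_contains_ball by blast
      then have "sphere_recip (of_real (e / 2)) \<in> T" by (auto simp: subset_iff)
      then show "\<exists>y. y \<in> range Some \<and> y \<in> T"
        using \<open>e > 0\<close> by (auto simp: sphere_recip_def)
    qed auto
    moreover have "range Some \<subseteq> stop riemann_sphere closure_of (range Some)"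
      by (rule closure_of_subset) simp
    ultimately have "x \<in> stop riemann_sphere closure_of (range Some)" for x
      by (cases x) auto
    then show ?thesis by auto
  qed
  ultimately have "connected_space (stop riemann_sphere)"
    using connectedin_closure_of connectedin_topspace by fastforce
  moreover have "Hausdorff_space (stop riemann_sphere)"
    unfolding stop_sphere Hausdorff_space_Alexandroff_compactification
    by (simp add: locally_compact_space_euclidean)
  moreover have "(\<Union>(U, \<phi>)\<in>atlas riemann_sphere. U) = UNIV"
  proof -
    have "x \<in> range Some \<union> (- {Some 0})" for x :: sphere_pt by (cases x) auto
    then show ?thesis unfolding atlas_sphere by blast
  qed
  moreover have "(\<psi> \<circ> inv_into U \<phi>) holomorphic_on \<phi> ` (U \<inter> V)"
    if UV: "(U, \<phi>) \<in> atlas riemann_sphere" "(V, \<psi>) \<in> atlas riemann_sphere" for U V \<phi> \<psi>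
  proof -
    have 1: "(the \<circ> sphere_recip) holomorphic_on recip_coord ` (- {Some 0} \<inter> range Some)"
      by (rule holomorphic_transform[of "\<lambda>w. 1 / w"])
         (auto intro!: holomorphic_intros simp: sphere_recip_def)
    have 2: "(recip_coord \<circ> Some) holomorphic_on the ` (range Some \<inter> - {Some 0})"
      by (rule holomorphic_transform[of "\<lambda>w. 1 / w"])
         (auto intro!: holomorphic_intros)
    have 3: "(recip_coord \<circ> sphere_recip) holomorphic_on A" "(the \<circ> Some) holomorphic_on A" for A
      by (rule holomorphic_transform[of "\<lambda>w. w"]; simp add: holomorphic_on_ident)+
    have inv: "inv_into (range Some) the = (Some :: complex \<Rightarrow> _)" "inv_into (- {Some 0}) recip_coord = sphere_recip"
      by auto
    consider "U = range Some" "\<phi> = the" "V = range Some" "\<psi> = the"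
      | "U = range Some" "\<phi> = the" "V = - {Some 0}" "\<psi> = recip_coord"
      | "U = - {Some 0}" "\<phi> = recip_coord" "V = range Some" "\<psi> = the"
      | "U = - {Some 0}" "\<phi> = recip_coord" "V = - {Some 0}" "\<psi> = recip_coord"
      using UV unfolding atlas_sphere by blast
    then show ?thesis using 1 2 3 inv by cases simp_all
  qed
  then have "\<forall>(U, \<phi>)\<in>atlas riemann_sphere. \<forall>(V, \<psi>)\<in>atlas riemann_sphere.
      (\<psi> \<circ> inv_into U \<phi>) holomorphic_on \<phi> ` (U \<inter> V)"
    by blast
  moreover have "\<forall>(U, \<phi>)\<in>atlas riemann_sphere. openin (stop riemann_sphere) U \<and> open (\<phi> ` U) \<and>
      homeomorphic_map (subtopology (stop riemann_sphere) U) (top_of_set (\<phi> ` U)) \<phi>"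
    by (auto simp: atlas_sphere openin_sphere_charts sphere_chart_homeomorphic)
  ultimately show ?thesis
    unfolding riemann_surface_def points_sphere by blast
qed

section \<open>Holomorphic maps into and out of the sphere; rational functions\<close>

lemma holomorphic_map_quotient:
  assumes D: "open D" "connected D" "D \<noteq> {}"
    and u: "u holomorphic_on D" and v: "v holomorphic_on D"
    and nz: "\<And>z. z \<in> D \<Longrightarrow> u z \<noteq> 0 \<or> v z \<noteq> 0"
  shows "holomorphic_map (planar_surface D) riemann_sphere (\<lambda>z. if v z = 0 then None else Some (u z / v z))"
    (is "holomorphic_map _ _ ?h")
proof (rule holomorphic_map_if_holo_at[OF riemann_surface_planar[OF D] riemann_surface_sphere])
  fix z assume "z \<in> points (planar_surface D)"
  then have z: "z \<in> D" by simp
  show "holo_at (planar_surface D) riemann_sphere ?h z"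
  \<comment> \<open>Away from the zeros of \<open>v\<close> the finite chart shows
    \<open>u / v\<close>. At a zero of \<open>v\<close> the numerator does not vanish, and the chart
    at infinity shows \<open>v / u\<close>, which is 0 exactly where the value is
    \<open>None\<close>.\<close>
  proof (cases "v z = 0")
    case False
    define N where "N = D \<inter> v -` (- {0})"
    have "open N"
      unfolding N_def by (intro continuous_open_preimage holomorphic_on_imp_continuous_on v D) auto
    moreover have "(the \<circ> ?h) holomorphic_on N"
    proof (rule holomorphic_transform)
      show "(\<lambda>z. u z / v z) holomorphic_on N"
        by (intro holomorphic_intros holomorphic_on_subset[OF u] holomorphic_on_subset[OF v]) (auto simp: N_def)
    qed (auto simp: N_def)
    moreover have "z \<in> N" "N \<subseteq> D" "?h ` N \<subseteq> range Some" using False z by (auto simp: N_def)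
    ultimately show ?thesis
      unfolding holo_at_planar_iff[OF D(1)] atlas_sphere by blast
  next
    case True
    define N where "N = D \<inter> u -` (- {0})"
    have "open N"
      unfolding N_def by (intro continuous_open_preimage holomorphic_on_imp_continuous_on u D) auto
    moreover have "(recip_coord \<circ> ?h) holomorphic_on N"
    proof (rule holomorphic_transform)
      show "(\<lambda>z. v z / u z) holomorphic_on N"
        by (intro holomorphic_intros holomorphic_on_subset[OF u] holomorphic_on_subset[OF v]) (auto simp: N_def)
    qed (auto simp: N_def)
    moreover have "z \<in> N" "N \<subseteq> D" "?h ` N \<subseteq> - {Some 0}" using True z nz by (auto simp: N_def)
    ultimately show ?thesis
      unfolding holo_at_planar_iff[OF D(1)] atlas_sphere by blast
  qed
qed

lemma holomorphic_map_sphereI: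
  assumes T: "riemann_surface T"
    and "holomorphic_map (planar_surface UNIV) T (h \<circ> Some)"
    and "holomorphic_map (planar_surface UNIV) T (h \<circ> sphere_recip)"
  shows "holomorphic_map riemann_sphere T h"
proof (rule holomorphic_map_if_holo_at[OF riemann_surface_sphere T])
  fix x :: sphere_pt
  have pl: "riemann_surface (planar_surface UNIV)" by (rule riemann_surface_planar) auto
  have inv: "h \<circ> inv_into (range Some) the = h \<circ> Some"
    "h \<circ> inv_into (- {Some 0}) recip_coord = h \<circ> sphere_recip" by auto
  show "holo_at riemann_sphere T h x"
  proof (cases "x = None")
    case True
    show ?thesis
      by (rule holo_at_chart[OF riemann_surface_sphere, of "- {Some 0}" recip_coord])
         (use True in \<open>auto simp: atlas_sphere inv intro!: holomorphic_map_imp_holo_at pl T assms\<close>)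
  next
    case False
    then show ?thesis
      by (intro holo_at_chart[OF riemann_surface_sphere, of "range Some" the])
         (auto simp: atlas_sphere inv intro!: holomorphic_map_imp_holo_at pl T assms)
  qed
qed

text \<open>In both coordinates of the source, \<open>f\<close> is a quotient of polynomials without
  common zeros. Near infinity these come from substituting \<open>z = 1 / w\<close> and multiplying
  numerator and denominator by \<open>w ^ d\<close>.\<close>

lemma holomorphic_map_rational:
  assumes "is_rational f"
  shows "holomorphic_map riemann_sphere riemann_sphere f"
proof -
  obtain p q where q0: "q \<noteq> 0" and cop: "coprime p q" and f: "f = rational_fun p q"
    using assms unfolding is_rational_def by blast
  define d where "d = max (degree p) (degree q)"
  \<comment> \<open>\<open>reflect_poly\<close> only clears the power \<open>degree r\<close>; the
    extra factor brings numerator and denominator to the common power \<open>d\<close>.\<close>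
  define rev where "rev = (\<lambda>r w. w ^ (d - degree r) * poly (reflect_poly r) (w::complex))"
  have rev_nz: "rev r w = w ^ d * poly r (1 / w)" if "w \<noteq> 0" "degree r \<le> d" for r w
    using that poly_reflect_poly_nz[of w r]
    by (simp add: rev_def inverse_eq_divide flip: power_add mult.assoc)
  \<comment> \<open>If \<open>degree r < d\<close>, the extra factor vanishes at 0 and so does
    \<open>coeff r d\<close>. This is the value that \<open>rational_fun\<close> uses at
    infinity.\<close>
  have rev_0: "rev r 0 = coeff r d" if "degree r \<le> d" for r
    using that by (cases "degree r = d") (auto simp: rev_def coeff_eq_0)
  have deg: "degree p \<le> d" "degree q \<le> d" by (auto simp: d_def)
  have no_common: "poly p z \<noteq> 0 \<or> poly q z \<noteq> 0" for z
    using cop by (metis coprime_poly_0)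
  have "f \<circ> Some = (\<lambda>z. if poly q z = 0 then None else Some (poly p z / poly q z))"
    by (auto simp: f rational_fun_def Let_def)
  then have 1: "holomorphic_map (planar_surface UNIV) riemann_sphere (f \<circ> Some)"
    using no_common by (auto intro!: holomorphic_map_quotient holomorphic_intros)
  have "f (sphere_recip w) = (if rev q w = 0 then None else Some (rev p w / rev q w))" for w
    using deg by (auto simp: f rational_fun_def Let_def sphere_recip_def rev_0 rev_nz simp flip: d_def)
  then have "f \<circ> sphere_recip = (\<lambda>w. if rev q w = 0 then None else Some (rev p w / rev q w))"
    by auto
  moreover have "rev p w \<noteq> 0 \<or> rev q w \<noteq> 0" for w
  proof (cases "w = 0")
    case True
    \<comment> \<open>A nonzero polynomial attaining the degree \<open>d\<close> has a nonzero
      coefficient there; if \<open>p = 0\<close>, then \<open>d = degree q\<close> and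
      \<open>q\<close> is such a polynomial.\<close>
    have "coeff p d \<noteq> 0 \<or> coeff q d \<noteq> 0"
      using q0 unfolding d_def max_def
      by (metis degree_0 le_zero_eq leading_coeff_0_iff nle_le)
    then show ?thesis using True deg by (simp add: rev_0)
  qed (use no_common deg in \<open>auto simp: rev_nz\<close>)
  moreover have "rev r holomorphic_on UNIV" for r
    unfolding rev_def by (intro holomorphic_intros)
  ultimately have 2: "holomorphic_map (planar_surface UNIV) riemann_sphere (f \<circ> sphere_recip)"
    using holomorphic_map_quotient[OF open_UNIV connected_UNIV UNIV_not_empty, of "rev p" "rev q"] by simp
  show ?thesis by (rule holomorphic_map_sphereI[OF riemann_surface_sphere 1 2])
qed

lemma holomorphic_map_funpow:
  assumes "riemann_surface S" "holomorphic_map S S f"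
  shows "holomorphic_map S S (f ^^ n)"
proof (induction n)
  case 0
  have "(\<psi> \<circ> id \<circ> inv_into U \<phi>) holomorphic_on \<phi> ` (U \<inter> id -` V)"
    if "(U, \<phi>) \<in> atlas S" "(V, \<psi>) \<in> atlas S" for U \<phi> V \<psi>
    using transition_holomorphic[OF assms(1) that] by (simp add: id_def o_def)
  then show ?case by (auto simp: holomorphic_map_def simp del: id_apply)
next
  case (Suc n)
  then show ?case
    using holomorphic_map_compose[OF assms(1) assms(1) assms(1) Suc assms(2)]
    by (simp only: funpow.simps)
qed

subsection \<open>The germ at a fixed point and its global semiconjugacy\<close>

lemma holomorphic_map_cong:
  assumes S: "riemann_surface S" and h: "holomorphic_map S T h" and eq: "\<And>x. x \<in> points S \<Longrightarrow> h x = k x"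
  shows "holomorphic_map S T k"
proof -
  have "(\<psi> \<circ> k \<circ> inv_into U \<phi>) holomorphic_on \<phi> ` (U \<inter> k -` V)"
    if U: "(U, \<phi>) \<in> atlas S" and V: "(V, \<psi>) \<in> atlas T" for U \<phi> V \<psi>
  proof (rule holomorphic_transform)
    have "U \<inter> k -` V = U \<inter> h -` V" using chart_subset[OF S U] eq by fastforce
    then show "(\<psi> \<circ> h \<circ> inv_into U \<phi>) holomorphic_on \<phi> ` (U \<inter> k -` V)"
      using h U V unfolding holomorphic_map_def by fastforce
    fix z assume "z \<in> \<phi> ` (U \<inter> k -` V)"
    then have "inv_into U \<phi> z \<in> points S" using chart_subset[OF S U] inv_into_into[of z \<phi> U] by auto
    then show "(\<psi> \<circ> h \<circ> inv_into U \<phi>) z = (\<psi> \<circ> k \<circ> inv_into U \<phi>) z" using eq by simp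
  qed
  then show ?thesis
    using h eq continuous_map_eq unfolding holomorphic_map_def by blast
qed

text \<open>Unifies the finite and the infinite case, so that the argument at a fixed point can work
  with an abstract chart.\<close>

lemma fixed_point_deriv_chart:
  obtains U \<phi> where "(U, \<phi>) \<in> atlas riemann_sphere" "a \<in> U"
    "fixed_point_deriv F a = deriv (\<phi> \<circ> F \<circ> inv_into U \<phi>) (\<phi> a)"
proof (cases "a = None")
  case True
  show ?thesis
    by (rule that[of "- {Some 0}" recip_coord]) (use True in \<open>auto simp: atlas_sphere fixed_point_deriv_def\<close>)
next
  case False
  show ?thesis
    by (rule that[of "range Some" the]) (use False in \<open>auto simp: atlas_sphere fixed_point_deriv_def\<close>)
qed

text \<open>In a chart at \<open>a\<close>, \<open>\<psi>\<close> becomes an injective holomorphic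
  \<open>\<alpha>\<close> with holomorphic inverse \<open>\<beta>\<close>, and \<open>F\<close>
  becomes \<open>H\<close>. The germ sought is the conjugate
  \<open>\<beta> \<circ> (H \<circ> \<alpha>)\<close>, and conjugation preserves the derivative at a
  fixed point.\<close>

lemma fixed_point_lift:
  assumes F: "holomorphic_map riemann_sphere riemann_sphere F" and Fa: "F a = a"
    and \<psi>: "holomorphic_map (planar_surface (ball 0 1)) riemann_sphere \<psi>"
    and inj: "inj_on \<psi> (ball 0 1)" and \<psi>0: "\<psi> 0 = a"
  obtains \<rho> G where "0 < \<rho>" "ball 0 \<rho> \<subseteq> ball (0::complex) 1" "G holomorphic_on ball 0 \<rho>"
    "G ` ball 0 \<rho> \<subseteq> ball 0 1" "\<And>z. z \<in> ball 0 \<rho> \<Longrightarrow> \<psi> (G z) = F (\<psi> z)"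
    "G 0 = 0" "deriv G 0 = fixed_point_deriv F a"
proof -
  note sph = riemann_surface_sphere
  have disc: "riemann_surface (planar_surface (ball (0::complex) 1))"
    by (rule riemann_surface_planar) auto
  obtain U \<phi> where U: "(U, \<phi>) \<in> atlas riemann_sphere" "a \<in> U"
    and deriv: "fixed_point_deriv F a = deriv (\<phi> \<circ> F \<circ> inv_into U \<phi>) (\<phi> a)"
    by (rule fixed_point_deriv_chart)
  have inv: "inv_into U \<phi> (\<phi> x) = x" if "x \<in> U" for x
    using chart_inj[OF sph U(1)] that by simp
  define H where "H = \<phi> \<circ> F \<circ> inv_into U \<phi>"
  define D where "D = \<phi> ` (U \<inter> F -` U)"
  define \<alpha> where "\<alpha> = \<phi> \<circ> \<psi>"
  define A where "A = ball 0 1 \<inter> \<psi> -` U"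
  have H: "H holomorphic_on D"
    using F U(1) unfolding H_def D_def holomorphic_map_def by fast
  have oD: "open D"
    using chart_domain_open[OF sph sph _ U(1) U(1), of F UNIV] F openin_topspace[of "stop riemann_sphere"]
    unfolding holomorphic_map_def D_def by simp
  have \<alpha>: "\<alpha> holomorphic_on A"
  proof (rule holomorphic_transform)
    show "(\<phi> \<circ> \<psi> \<circ> inv_into (ball 0 1) (\<lambda>z. z)) holomorphic_on A"
      using \<psi> U(1) unfolding A_def holomorphic_map_def by fastforce
  qed (simp add: \<alpha>_def A_def inv_into_ident)
  have oA: "open A"
    using chart_domain_open[OF disc sph _ _ U(1), of \<psi> "ball 0 1" "\<lambda>z. z" "ball 0 1"] \<psi>
      openin_topspace[of "top_of_set (ball (0::complex) 1)"]
    unfolding holomorphic_map_def A_def by (simp add: Int_absorb1 Int_commute Int_left_commute)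
  have inj\<alpha>: "inj_on \<alpha> A"
    unfolding \<alpha>_def using inj chart_inj[OF sph U(1)] by (intro comp_inj_on) (auto simp: A_def inj_on_def)
  have o\<alpha>A: "open (\<alpha> ` A)" by (rule open_mapping_thm3[OF \<alpha> oA inj\<alpha>])
  obtain \<beta> where \<beta>: "\<beta> holomorphic_on \<alpha> ` A" "\<And>z. z \<in> A \<Longrightarrow> deriv \<alpha> z * deriv \<beta> (\<alpha> z) = 1"
    "\<And>z. z \<in> A \<Longrightarrow> \<beta> (\<alpha> z) = z"
    using holomorphic_has_inverse[OF \<alpha> oA inj\<alpha>] by metis
  \<comment> \<open>On \<open>A'\<close> the composition \<open>H \<circ> \<alpha>\<close> makes
    sense; on \<open>B\<close> its value moreover returns to the range of \<open>\<alpha>\<close>,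
    so that \<open>\<beta>\<close> can be applied.\<close>
  define A' where "A' = A \<inter> \<alpha> -` D"
  define B where "B = A' \<inter> (H \<circ> \<alpha>) -` (\<alpha> ` A)"
  have oA': "open A'"
    unfolding A'_def by (intro continuous_open_preimage holomorphic_on_imp_continuous_on \<alpha> oA oD)
  have H\<alpha>: "(H \<circ> \<alpha>) holomorphic_on A'"
    by (rule holomorphic_on_compose_gen[OF holomorphic_on_subset[OF \<alpha>] H]) (auto simp: A'_def)
  have oB: "open B"
    unfolding B_def by (intro continuous_open_preimage holomorphic_on_imp_continuous_on H\<alpha> oA' o\<alpha>A)
  have \<alpha>0: "\<alpha> 0 = \<phi> a" and H0: "H (\<phi> a) = \<phi> a"
    using \<psi>0 Fa U by (auto simp: \<alpha>_def H_def inv)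
  have A0: "0 \<in> A" using \<psi>0 U by (simp add: A_def)
  have D0: "\<phi> a \<in> D" using U Fa by (auto simp: D_def)
  have B0: "0 \<in> B" using A0 D0 H0 \<alpha>0 unfolding B_def A'_def by (auto simp: image_iff) metis
  obtain \<rho> where \<rho>: "\<rho> > 0" "ball 0 \<rho> \<subseteq> B" using oB B0 open_contains_ball by blast
  define G where "G = \<beta> \<circ> (H \<circ> \<alpha>)"
  \<comment> \<open>If \<open>H (\<alpha> z) = \<alpha> w\<close>, then \<open>F (\<psi> z)\<close>
    and \<open>\<psi> w\<close> are points of \<open>U\<close> with the same coordinate, hence
    equal, and \<open>w\<close> is \<open>G z\<close>.\<close>
  have G: "G z \<in> ball 0 1 \<and> \<psi> (G z) = F (\<psi> z)" if z: "z \<in> B" for z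
  proof -
    obtain w where w: "w \<in> A" "H (\<alpha> z) = \<alpha> w" using z by (auto simp: B_def)
    have Gz: "G z = w" using w \<beta>(3) by (simp add: G_def)
    have zU: "\<psi> z \<in> U" using z by (auto simp: B_def A'_def A_def)
    obtain y where y: "y \<in> U" "F y \<in> U" "\<phi> (\<psi> z) = \<phi> y"
      using z by (auto simp: B_def A'_def D_def \<alpha>_def)
    then have FU: "F (\<psi> z) \<in> U" using inv zU by metis
    have "\<phi> (F (\<psi> z)) = \<phi> (\<psi> w)" using w(2) zU by (simp add: H_def \<alpha>_def inv)
    moreover have "\<psi> w \<in> U" "w \<in> ball 0 1" using w(1) by (auto simp: A_def)
    ultimately show ?thesis using FU inv Gz by metis
  qed
  show ?thesis
  proof (rule that[of \<rho> G])
    show "ball 0 \<rho> \<subseteq> ball (0::complex) 1" using \<rho> by (auto simp: B_def A'_def A_def)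
    have "G holomorphic_on B"
      unfolding G_def
      by (rule holomorphic_on_compose_gen[OF holomorphic_on_subset[OF H\<alpha>] \<beta>(1)]) (auto simp: B_def)
    then show "G holomorphic_on ball 0 \<rho>" using \<rho> holomorphic_on_subset by blast
    show "G ` ball 0 \<rho> \<subseteq> ball 0 1" "\<And>z. z \<in> ball 0 \<rho> \<Longrightarrow> \<psi> (G z) = F (\<psi> z)"
      using G \<rho> by blast+
    show "G 0 = 0" using \<beta>(3)[OF A0] \<alpha>0 H0 by (simp add: G_def)
    have "(\<alpha> has_field_derivative deriv \<alpha> 0) (at 0)"
      using holomorphic_derivI[OF \<alpha> oA A0] .
    moreover have "(H has_field_derivative deriv H (\<phi> a)) (at (\<alpha> 0))"
      using holomorphic_derivI[OF H oD D0] \<alpha>0 by simp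
    moreover have "(\<beta> has_field_derivative deriv \<beta> (\<alpha> 0)) (at ((H \<circ> \<alpha>) 0))"
      using holomorphic_derivI[OF \<beta>(1) o\<alpha>A imageI[OF A0]] \<alpha>0 H0 by simp
    ultimately have "(G has_field_derivative deriv \<beta> (\<alpha> 0) * (deriv H (\<phi> a) * deriv \<alpha> 0)) (at 0)"
      unfolding G_def by (intro DERIV_chain)
    then have "deriv G 0 = deriv \<beta> (\<alpha> 0) * (deriv H (\<phi> a) * deriv \<alpha> 0)" by (rule DERIV_imp_deriv)
    also have "\<dots> = deriv H (\<phi> a) * (deriv \<alpha> 0 * deriv \<beta> (\<alpha> 0))" by (simp only: mult_ac)
    also have "\<dots> = deriv H (\<phi> a)" using \<beta>(2)[OF A0] by simp
    finally show "deriv G 0 = fixed_point_deriv F a" unfolding deriv H_def .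
  qed (use \<rho> in auto)
qed

text \<open>Along a real sequence tending to 0 the difference quotients are real, and the reals are
  closed in the plane.\<close>

lemma deriv_real_on_reals:
  assumes "G holomorphic_on ball 0 \<rho>" "\<rho> > 0" and real: "\<And>x. x \<in> ball 0 \<rho> \<inter> \<real> \<Longrightarrow> G x \<in> \<real>"
  shows "deriv G 0 \<in> \<real>"
proof -
  have "(G has_field_derivative deriv G 0) (at 0)"
    using assms by (intro holomorphic_derivI[OF _ open_ball]) auto
  then have lim: "((\<lambda>y. (G y - G 0) / (y - 0)) \<longlongrightarrow> deriv G 0) (at 0)"
    by (simp add: has_field_derivative_iff)
  \<comment> \<open>The offset 2 keeps the first term strictly inside the disc; an offset 1 would
    start on its boundary.\<close>
  define x :: "nat \<Rightarrow> complex" where "x = (\<lambda>n. of_real (\<rho> / real (n + 2)))"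
  have "norm (x n) = \<rho> / real (n + 2)" for n
    unfolding x_def norm_of_real using assms(2) by simp
  moreover have "\<rho> / real (n + 2) < \<rho>" "\<rho> / real (n + 2) > 0" for n
    using assms(2) by (auto simp: field_simps add_pos_nonneg)
  ultimately have x: "x n \<in> ball 0 \<rho>" "x n \<noteq> 0" for n
    by (simp, metis norm_zero less_irrefl)
  have xR: "x n \<in> \<real>" for n unfolding x_def by (rule Reals_of_real)
  have "(\<lambda>n. \<rho> / real (n + 2)) \<longlonglongrightarrow> 0"
    by (rule LIMSEQ_ignore_initial_segment[OF lim_const_over_n])
  from tendsto_of_real[OF this, where 'a = complex] have "x \<longlonglongrightarrow> 0"
    by (simp only: x_def of_real_0)
  then have "filterlim x (at 0) sequentially"
    using x by (simp add: filterlim_at)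
  from filterlim_compose[OF lim this]
  have limx: "(\<lambda>n. (G (x n) - G 0) / (x n - 0)) \<longlonglongrightarrow> deriv G 0" .
  have "(G (x n) - G 0) / (x n - 0) \<in> \<real>" for n
    using real x xR assms(2) by (intro Reals_divide Reals_diff) auto
  then show ?thesis by (rule closed_sequentially[OF closed_complex_Reals _ limx])
qed

lemma anticonformal_involution_cnj: "anticonformal_involution (planar_surface UNIV) cnj"
proof -
  have "(cnj \<circ> (\<lambda>z. z) \<circ> cnj \<circ> inv_into UNIV (\<lambda>z. z)) = (\<lambda>z. z)"
    by (auto simp: inv_into_ident)
  then show ?thesis
    unfolding anticonformal_involution_def antiholomorphic_map_def
    by (auto simp: continuous_on_cnj)
qed

text \<open>The extension is \<open>(F ^^ n) (k (z / lam ^ n))\<close> for any \<open>n\<close>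
  large enough to bring \<open>z / lam ^ n\<close> into the disc; the local equation makes the value
  independent of \<open>n\<close>. A single \<open>n\<close> serves on each disc of radius
  \<open>r * norm lam ^ n\<close>, and these discs exhaust the plane.\<close>

lemma local_semiconjugacy_extends:
  assumes F: "holomorphic_map riemann_sphere riemann_sphere F" and lam: "norm lam > 1" and r: "r > 0"
    and k: "holomorphic_map (planar_surface (ball 0 r)) riemann_sphere k"
    and eq: "\<And>z. norm (lam * z) < r \<Longrightarrow> k (lam * z) = F (k z)"
  obtains h where "holomorphic_map (planar_surface UNIV) riemann_sphere h"
    "\<And>z. h (lam * z) = F (h z)"
    "\<And>n z. norm (z / lam ^ n) < r \<Longrightarrow> h z = (F ^^ n) (k (z / lam ^ n))"
proof -
  note sph = riemann_surface_sphere
  have lam0: "lam \<noteq> 0" using lam by auto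
  \<comment> \<open>The least admissible exponent merely fixes a choice; fact \<open>h\<close> below
    shows that every admissible exponent gives the same value, by induction upwards from this
    one.\<close>
  define N where "N = (\<lambda>z. LEAST n. norm (z / lam ^ n) < r)"
  define h where "h = (\<lambda>z. (F ^^ N z) (k (z / lam ^ N z)))"
  have ex: "\<exists>n. norm (z / lam ^ n) < r" for z
  proof -
    obtain n where "norm z / r < norm lam ^ n" using real_arch_pow[OF lam] by blast
    then have "norm (z / lam ^ n) < r"
      using r lam0 by (simp add: norm_divide norm_power field_simps)
    then show ?thesis ..
  qed
  have rescale: "(F ^^ Suc n) (k (z / lam ^ Suc n)) = (F ^^ n) (k (z / lam ^ n)) \<and> norm (z / lam ^ Suc n) < r"
    if "norm (z / lam ^ n) < r" for n z
  proof -
    have e: "lam * (z / lam ^ Suc n) = z / lam ^ n" using lam0 by simp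
    have "norm (z / lam ^ Suc n) \<le> norm (lam * (z / lam ^ Suc n))"
      unfolding norm_mult using lam by (simp add: mult_le_cancel_right1 del: power_Suc)
    then have "norm (z / lam ^ Suc n) < r" using that unfolding e by linarith
    moreover have "k (z / lam ^ n) = F (k (z / lam ^ Suc n))"
      using eq[of "z / lam ^ Suc n"] that unfolding e by blast
    ultimately show ?thesis by (simp only: funpow_Suc_right o_apply)
  qed
  have h: "h z = (F ^^ n) (k (z / lam ^ n))" if "norm (z / lam ^ n) < r" for n z
  proof -
    have "N z \<le> n" unfolding N_def using that by (rule Least_le)
    then have "norm (z / lam ^ n) < r \<and> (F ^^ n) (k (z / lam ^ n)) = h z"
    proof (induction n rule: dec_induct)
      case base
      show ?case using LeastI_ex[OF ex[of z]] by (simp add: h_def N_def)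
    next
      case (step n)
      then show ?case using rescale[of z n] by metis
    qed
    then show ?thesis by simp
  qed
  show ?thesis
  proof (rule that[of h])
    show "h z = (F ^^ n) (k (z / lam ^ n))" if "norm (z / lam ^ n) < r" for n z
      using that by (rule h)
    show "h (lam * z) = F (h z)" for z
    proof -
      obtain n where n: "norm (z / lam ^ n) < r" using ex by blast
      \<comment> \<open>Exponent \<open>Suc n\<close> at \<open>lam * z\<close> evaluates
        \<open>k\<close> at the same point as exponent \<open>n\<close> at \<open>z\<close>, which
        leaves exactly one more application of \<open>F\<close>.\<close>
      have e: "lam * z / lam ^ Suc n = z / lam ^ n" using lam0 by simp
      have "h (lam * z) = (F ^^ Suc n) (k (lam * z / lam ^ Suc n))"
        by (rule h) (use n e in simp)
      then show ?thesis using h[OF n] e by simp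
    qed
    show "holomorphic_map (planar_surface UNIV) riemann_sphere h"
    proof (rule holomorphic_map_glue[OF open_UNIV connected_UNIV UNIV_not_empty sph])
      fix x :: complex
      obtain n where n: "norm (x / lam ^ n) < r" using ex by blast
      define E where "E = ball (0::complex) (r * norm lam ^ n)"
      have nE: "norm (z / lam ^ n) < r \<longleftrightarrow> z \<in> E" for z
        using lam0 by (simp add: E_def norm_divide norm_power field_simps)
      have E: "open E" "connected E" "x \<in> E" using n nE by (auto simp: E_def)
      have sE: "riemann_surface (planar_surface E)" using E by (intro riemann_surface_planar) auto
      have sr: "riemann_surface (planar_surface (ball (0::complex) r))"
        using r by (intro riemann_surface_planar) auto
      have "holomorphic_map (planar_surface E) (planar_surface (ball 0 r)) (\<lambda>z. z / lam ^ n)"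
        using lam0 nE by (intro holomorphic_map_planar) (auto intro!: holomorphic_intros)
      from holomorphic_map_compose[OF sE sph sph holomorphic_map_compose[OF sE sr sph this k]
          holomorphic_map_funpow[OF sph F, of n]]
      have "holomorphic_map (planar_surface E) riemann_sphere h"
        by (rule holomorphic_map_cong[OF sE]) (simp add: h[where n = n] nE)
      then show "\<exists>E. open E \<and> connected E \<and> x \<in> E \<and> E \<subseteq> UNIV \<and> holomorphic_map (planar_surface E) riemann_sphere h"
        using E by blast
    qed
  qed
qed

section \<open>The semiconjugacy at the repelling periodic point\<close>

theorem theorem1:
  fixes f :: "sphere_pt \<Rightarrow> sphere_pt" and \<gamma> :: "sphere_pt set" and a :: sphere_pt and lam :: complex
  assumes "is_rational f"
    and "jordan_analytic_curve \<gamma>"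
    and "f ` \<gamma> \<subseteq> \<gamma>"
    and "\<not> homeomorphic_map (subtopology (stop riemann_sphere) \<gamma>)
              (subtopology (stop riemann_sphere) \<gamma>) f"
    and "a \<in> \<gamma>" and "repelling f a" and "lam = multiplier f a"
    and "(\<forall>x\<in>\<gamma>. \<not> critical_fixed_point f x \<and> \<not> neutral_rational_fixed_point f x)
         \<or> \<gamma> \<subseteq> julia_set f"
  shows "lam \<in> \<real> \<and>
    (\<exists>(S :: complex surface) s g h n.
        non_hyperbolic S \<and> anticonformal_involution S s \<and>
        holomorphic_map S S g \<and>
        holomorphic_map S riemann_sphere h \<and> \<not> h constant_on points S \<and>
        (\<forall>x\<in>points S. g (s x) = s (g x)) \<and>
        h ` {x \<in> points S. s x = x} \<subseteq> \<gamma> \<and>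
        n \<ge> 1 \<and> (\<forall>x\<in>points S. h (g x) = (f ^^ n) (h x)))"
proof -
  define p where "p = period f a"
  have "\<exists>p. p \<ge> 1 \<and> (f ^^ p) a = a"
    using assms(6) by (auto simp: repelling_def periodic_point_def)
  from LeastI_ex[OF this] have p: "p \<ge> 1" "(f ^^ p) a = a" by (auto simp: p_def period_def)
  define F where "F = f ^^ p"
  have F: "holomorphic_map riemann_sphere riemann_sphere F"
    unfolding F_def by (intro holomorphic_map_funpow riemann_surface_sphere holomorphic_map_rational assms)
  have inv: "(f ^^ n) x \<in> \<gamma>" if "x \<in> \<gamma>" for n x
    using that assms(3) by (induction n) auto
  have F\<gamma>: "(F ^^ n) x \<in> \<gamma>" if "x \<in> \<gamma>" for n x
    using that inv by (induction n) (auto simp: F_def)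
  obtain \<psi> where \<psi>: "holomorphic_map (planar_surface (ball 0 1)) riemann_sphere \<psi>"
    "inj_on \<psi> (ball 0 1)" "\<psi> 0 = a" "\<psi> ` ball 0 1 \<inter> \<gamma> = \<psi> ` (ball 0 1 \<inter> \<real>)"
    using assms(2,5) unfolding jordan_analytic_curve_def real_analytic_curve_def by blast
  have Fa: "F a = a" using p by (simp add: F_def)
  obtain \<rho> G where \<rho>: "0 < \<rho>" "ball 0 \<rho> \<subseteq> ball (0::complex) 1" and G: "G holomorphic_on ball 0 \<rho>"
      "G ` ball 0 \<rho> \<subseteq> ball 0 1" "\<And>z. z \<in> ball 0 \<rho> \<Longrightarrow> \<psi> (G z) = F (\<psi> z)" "G 0 = 0"
    and dG: "deriv G 0 = fixed_point_deriv F a"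
    using fixed_point_lift[OF F Fa \<psi>(1-3)] by metis
  have lamG: "deriv G 0 = lam" using dG assms(7) by (simp add: F_def p_def multiplier_def)
  have lam1: "norm lam > 1" using assms(6,7) by (simp add: repelling_def)
  \<comment> \<open>In the coordinate \<open>\<psi>\<close> the curve is exactly the real interval:
    a real \<open>x\<close> gives a point of \<open>\<gamma>\<close>, invariance keeps
    \<open>\<psi> (G x)\<close> on \<open>\<gamma>\<close>, and injectivity of \<open>\<psi>\<close>
    then forces \<open>G x\<close> to be real.\<close>
  have GR: "G x \<in> \<real>" if x: "x \<in> ball 0 \<rho> \<inter> \<real>" for x
  proof -
    have "\<psi> x \<in> \<gamma>" using x \<rho>(2) \<psi>(4) by blast
    then have "\<psi> (G x) \<in> \<gamma>" using F\<gamma>[of "\<psi> x" 1] G(3) x by simp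
    moreover have G1: "G x \<in> ball 0 1" using G(2) x by blast
    ultimately have "\<psi> (G x) \<in> \<psi> ` (ball 0 1 \<inter> \<real>)" using \<psi>(4) by blast
    then show ?thesis using \<psi>(2) G1 by (metis IntD1 IntD2 image_iff inj_onD)
  qed
  have lamR: "lam \<in> \<real>" using deriv_real_on_reals[OF G(1) \<rho>(1) GR] lamG by simp
  obtain r \<Psi> where r: "r > 0" and \<Psi>: "\<Psi> holomorphic_on ball 0 r" "deriv \<Psi> 0 = 1"
      "\<Psi> ` ball 0 r \<subseteq> ball 0 \<rho>" "\<And>z. norm (lam * z) < r \<Longrightarrow> \<Psi> (lam * z) = G (\<Psi> z)"
    and "lam \<in> \<real> \<Longrightarrow> (\<And>x. x \<in> ball 0 \<rho> \<inter> \<real> \<Longrightarrow> G x \<in> \<real>) \<Longrightarrow> \<Psi> ` (ball 0 r \<inter> \<real>) \<subseteq> \<real>"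
    using poincare_function_local[OF G(1) \<rho>(1) G(4) lamG lam1] by metis
  then have \<Psi>R: "\<Psi> ` (ball 0 r \<inter> \<real>) \<subseteq> \<real>" using lamR GR by blast
  have "\<Psi> ` ball 0 r \<subseteq> ball 0 1" using \<Psi>(3) \<rho>(2) by blast
  then have "holomorphic_map (planar_surface (ball 0 r)) (planar_surface (ball 0 1)) \<Psi>"
    by (intro holomorphic_map_planar \<Psi>)
  then have k: "holomorphic_map (planar_surface (ball 0 r)) riemann_sphere (\<psi> \<circ> \<Psi>)"
    using r \<psi>(1) by (intro holomorphic_map_compose[where T = "planar_surface (ball 0 1)"]
        riemann_surface_planar riemann_surface_sphere) auto
  have keq: "(\<psi> \<circ> \<Psi>) (lam * z) = F ((\<psi> \<circ> \<Psi>) z)" if "norm (lam * z) < r" for z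
  proof -
    have "norm z \<le> norm (lam * z)" using lam1 by (simp add: norm_mult mult_le_cancel_right1)
    then have "\<Psi> z \<in> ball 0 \<rho>" using that \<Psi>(3) by (intro subsetD[OF \<Psi>(3)] imageI) simp
    then show ?thesis using \<Psi>(4)[OF that] G(3) by simp
  qed
  obtain h where h: "holomorphic_map (planar_surface UNIV) riemann_sphere h"
    "\<And>z. h (lam * z) = F (h z)"
    "\<And>n z. norm (z / lam ^ n) < r \<Longrightarrow> h z = (F ^^ n) ((\<psi> \<circ> \<Psi>) (z / lam ^ n))"
    using local_semiconjugacy_extends[OF F lam1 r k keq] by blast
  \<comment> \<open>Near 0 exponent 0 is admissible, so \<open>h\<close> agrees there with
    \<open>\<psi> \<circ> \<Psi>\<close>. Were it constant, injectivity of \<open>\<psi>\<close>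
    would make \<open>\<Psi>\<close> constant, against \<open>deriv \<Psi> 0 = 1\<close>.\<close>
  have nonconst: "\<not> h constant_on UNIV"
  proof
    assume "h constant_on UNIV"
    then obtain c where c: "\<And>z. h z = c" by (auto simp: constant_on_def)
    have \<Psi>c: "\<Psi> z = \<Psi> 0" if "z \<in> ball 0 r" for z
    proof (rule inj_onD[OF \<psi>(2)])
      show "\<psi> (\<Psi> z) = \<psi> (\<Psi> 0)" using h(3)[of z 0] h(3)[of 0 0] c that r by simp
      show "\<Psi> z \<in> ball 0 1" "\<Psi> 0 \<in> ball 0 1" using that r \<Psi>(3) \<rho>(2) by fastforce+
    qed
    have "eventually (\<lambda>z. z \<in> ball 0 r) (nhds (0::complex))"
      using r by (intro eventually_nhds_in_open) auto
    then have "eventually (\<lambda>z. \<Psi> z = \<Psi> 0) (nhds 0)" by eventually_elim (rule \<Psi>c)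
    then have "deriv \<Psi> 0 = deriv (\<lambda>z. \<Psi> 0) 0" by (rule deriv_cong_ev) simp
    then show False using \<Psi>(2) by simp
  qed
  \<comment> \<open>Because \<open>lam\<close> is real, rescaling a fixed point of conjugation keeps
    it real; near 0 it is sent into \<open>\<gamma>\<close>, and iterating \<open>F\<close> does not
    leave the invariant curve.\<close>
  have h\<gamma>: "h x \<in> \<gamma>" if x: "cnj x = x" for x
  proof -
    have xR: "x \<in> \<real>" using x by (simp add: Reals_cnj_iff)
    obtain n where "norm x / r < norm lam ^ n" using real_arch_pow[OF lam1] by blast
    then have n: "norm (x / lam ^ n) < r"
      using r lam1 by (simp add: norm_divide norm_power divide_less_eq mult.commute)
    have "x / lam ^ n \<in> ball 0 r \<inter> \<real>" using n xR lamR by simp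
    then have "\<Psi> (x / lam ^ n) \<in> \<real>" "\<Psi> (x / lam ^ n) \<in> ball 0 1"
      using \<Psi>R \<Psi>(3) \<rho>(2) by blast+
    then have "\<psi> (\<Psi> (x / lam ^ n)) \<in> \<gamma>" using \<psi>(4) by blast
    then show ?thesis using h(3)[OF n] F\<gamma> by simp
  qed
  have g: "holomorphic_map (planar_surface UNIV) (planar_surface UNIV) (\<lambda>z. lam * z)"
    by (intro holomorphic_map_planar) (auto intro!: holomorphic_intros)
  have main: "non_hyperbolic (planar_surface UNIV) \<and> anticonformal_involution (planar_surface UNIV) cnj \<and>
      holomorphic_map (planar_surface UNIV) (planar_surface UNIV) (\<lambda>z. lam * z) \<and>
      holomorphic_map (planar_surface UNIV) riemann_sphere h \<and>
      \<not> h constant_on points (planar_surface UNIV) \<and>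
      (\<forall>z\<in>points (planar_surface UNIV). lam * cnj z = cnj (lam * z)) \<and>
      h ` {z \<in> points (planar_surface UNIV). cnj z = z} \<subseteq> \<gamma> \<and>
      p \<ge> 1 \<and> (\<forall>z\<in>points (planar_surface UNIV). h (lam * z) = (f ^^ p) (h z))"
  proof (intro conjI ballI)
    show "h ` {z \<in> points (planar_surface UNIV). cnj z = z} \<subseteq> \<gamma>" using h\<gamma> by blast
    show "lam * cnj z = cnj (lam * z)" for z using lamR by (simp add: Reals_cnj_iff)
    show "h (lam * z) = (f ^^ p) (h z)" for z using h(2) by (simp add: F_def)
  qed (use non_hyperbolic_plane anticonformal_involution_cnj g h(1) nonconst p(1) in simp_all)
  show ?thesis
    by (rule conjI[OF lamR], rule exI[of _ "planar_surface UNIV"], rule exI[of _ cnj],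
        rule exI[of _ "\<lambda>z. lam * z"], rule exI[of _ h], rule exI[of _ p], rule main)
qed

end
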